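(* Let $\mathcal I$ be a model. Then for all $n\ge 0$: (1) $d^G_n=d^W_n=d^K_n=d^L_n$ on $\Delta^{\mathcal I}$; call this pseudometric $d_n$; (2) the pseudometric space $(\Delta^{\mathcal I},d_n)$ is totally bounded; (3) the set $\{C^{\mathcal I}\mid C\text{ an }\mathcal{ALC}(\Diamond)\text{-concept with }\mathsf{rk}(C)\le n\}$ is a dense subset of the space of non-expansive maps $(\Delta^{\mathcal I},d_n)\to[0,1]$, equipped with the supremum metric.
   Context: Models: fix a finite set $N_C$ of atomic concepts and a single role. A model $\mathcal I$ consists of a set $\Delta^{\mathcal I}$ of states, maps $A^{\mathcal I}:\Delta^{\mathcal I}\to[0,1]$ for $A\in N_C$, and $r^{\mathcal I}:\Delta^{\mathcal I}\times\Delta^{\mathcal I}\to[0,1]$ such that for each $a$, $r_a:=r^{\mathcal I}(a,\cdot)$ satisfies $\sum_{a'}r_a(a')\in\{0,1\}$; $a$ is blocking if the sum is $0$, and otherwise $r_a$ is a discrete probability distribution. $\mathrm{E}_{\pi}(f)=\sum_x\pi(x)f(x)$. Concepts of $\mathcal{ALC}(\Diamond)$: $C,D::=q\mid A\mid C\ominus q\mid\neg C\mid C\wedge D\mid\Diamond C$ ($q\in\mathbb Q\cap[0,1]$, $A\in N_C$), with $q^{\mathcal I}(a)=q$, $(C\ominus q)^{\mathcal I}(a)=\max(C^{\mathcal I}(a)-q,0)$, $(\neg C)^{\mathcal I}=1-C^{\mathcal I}$, $(C\wedge D)^{\mathcal I}=\min(C^{\mathcal I},D^{\mathcal I})$, $(\Diamond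 C)^{\mathcal I}(a)=\mathrm{E}_{r_a}(C^{\mathcal I})$. $\mathsf{rk}(C)$ is the maximal nesting depth of $\Diamond$ and atomic concepts in $C$. A map $f:X\to[0,1]$ is non-expansive wrt. a pseudometric $d$ if $|f(x)-f(y)|\le d(x,y)$. A pseudometric space is totally bounded if for every $\epsilon>0$ it is covered by finitely many closed $\epsilon$-balls. Liftings: for a pseudometric $d$ on $X$ and discrete distributions $\pi_1,\pi_2$ on $X$, Kantorovich $d^\uparrow(\pi_1,\pi_2)=\sup\{|\mathrm{E}_{\pi_1}(f)-\mathrm{E}_{\pi_2}(f)|\mid f\text{ non-expansive }X\to[0,1]\}$ and Wasserstein $d^\downarrow(\pi_1,\pi_2)=\inf\{\mathrm{E}_\mu(d)\mid\mu\in\mathrm{cpl}(\pi_1,\pi_2)\}$, where $\mathrm{cpl}(\pi_1,\pi_2)$ is the set of distributions on $X\times X$ with marginals $\pi_1,\pi_2$. By convention the zero function has distance $1$ from every probability distribution, and two zero functions have distance $0$. Distances: $d^W_0=d^K_0=0$; $d^W_{n+1}(a,b)=\max_{A}|A^{\mathcal I}(a)-A^{\mathcal I}(b)|\vee(d^W_n)^\downarrow(r_a,r_b)$; $d^K_{n+1}(a,b)=\max_{A}|A^{\mathcal I}(a)-A^{\mathcal I}(b)|\vee(d^K_n)^\uparrow(r_a,r_b)$; $d^L_n(a,b)=\sup\{|C^{\mathcal I}(a)-C^{\mathcal I}(b)|\mid\mathsf{rk}(C)\le n\}$. Bisimulation game: configurations $(a,b,\epsilon)$; in each round Duplicator picks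 $\mu\in\mathrm{cpl}(r_a,r_b)$ and $\epsilon':\Delta\times\Delta\to[0,1]$ with $\mathrm{E}_\mu(\epsilon')\le\epsilon$; Spoiler picks $(a',b')$ with $\mu(a',b')>0$; new configuration $(a',b',\epsilon'(a',b'))$. Before every round: Duplicator wins if both states are blocking or $\epsilon=1$; Spoiler wins if exactly one is blocking and $\epsilon<1$, or if $|A^{\mathcal I}(a)-A^{\mathcal I}(b)|>\epsilon$ for some $A$. Duplicator wins the $n$-round game once $n$ rounds have been played (conditions not checked after the last round). $d^G_n(a,b)$ is the infimum of $\epsilon$ for which Duplicator wins the $n$-round game from $(a,b,\epsilon)$. *)

theory Defs
  imports "HOL-Analysis.Analysis"
begin

record ('s, 'c) model =
  states :: "'s set"
  conc :: "'c \<Rightarrow> 's \<Rightarrow> real"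
  role :: "'s \<Rightarrow> 's \<Rightarrow> real"

text \<open>The sum condition uses \<^const>\<open>has_sum\<close>: an \<^const>\<open>infsum\<close> is \<open>0\<close> also for
  families that are not summable.\<close>

definition is_model :: "'c set \<Rightarrow> ('s, 'c) model \<Rightarrow> bool" where
  "is_model NC I \<longleftrightarrow>
     (\<forall>A\<in>NC. \<forall>a\<in>states I. conc I A a \<in> {0..1}) \<and>
     (\<forall>a\<in>states I. \<forall>b\<in>states I. role I a b \<in> {0..1}) \<and>
     (\<forall>a\<in>states I. (role I a has_sum 0) (states I) \<or> (role I a has_sum 1) (states I))"

definition blocking :: "('s, 'c) model \<Rightarrow> 's \<Rightarrow> bool" where
  "blocking I a \<longleftrightarrow> (role I a has_sum 0) (states I)"

definition expect :: "'a set \<Rightarrow> ('a \<Rightarrow> real) \<Rightarrow> ('a \<Rightarrow> real) \<Rightarrow> real" where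
  "expect X \<pi> f = (\<Sum>\<^sub>\<infinity>x\<in>X. \<pi> x * f x)"

datatype 'c concept =
    Rational rat
  | Atom 'c
  | Minus "'c concept" rat
  | Neg "'c concept"
  | Conj "'c concept" "'c concept"
  | Diamond "'c concept"

primrec concept_over :: "'c set \<Rightarrow> 'c concept \<Rightarrow> bool" where
  "concept_over NC (Rational q) \<longleftrightarrow> 0 \<le> q \<and> q \<le> 1"
| "concept_over NC (Atom A) \<longleftrightarrow> A \<in> NC"
| "concept_over NC (Minus C q) \<longleftrightarrow> concept_over NC C \<and> 0 \<le> q \<and> q \<le> 1"
| "concept_over NC (Neg C) \<longleftrightarrow> concept_over NC C"
| "concept_over NC (Conj C D) \<longleftrightarrow> concept_over NC C \<and> concept_over NC D"
| "concept_over NC (Diamond C) \<longleftrightarrow> concept_over NC C"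

primrec interp :: "('s, 'c) model \<Rightarrow> 'c concept \<Rightarrow> 's \<Rightarrow> real" where
  "interp I (Rational q) = (\<lambda>a. of_rat q)"
| "interp I (Atom A) = conc I A"
| "interp I (Minus C q) = (\<lambda>a. max (interp I C a - of_rat q) 0)"
| "interp I (Neg C) = (\<lambda>a. 1 - interp I C a)"
| "interp I (Conj C D) = (\<lambda>a. min (interp I C a) (interp I D a))"
| "interp I (Diamond C) = (\<lambda>a. expect (states I) (role I a) (interp I C))"

primrec rk :: "'c concept \<Rightarrow> nat" where
  "rk (Rational q) = 0"
| "rk (Atom A) = 1"
| "rk (Minus C q) = rk C"
| "rk (Neg C) = rk C"
| "rk (Conj C D) = max (rk C) (rk D)"
| "rk (Diamond C) = Suc (rk C)"

definition pseudometric_on :: "'a set \<Rightarrow> ('a \<Rightarrow> 'a \<Rightarrow> real) \<Rightarrow> bool" where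
  "pseudometric_on X d \<longleftrightarrow>
     (\<forall>x\<in>X. \<forall>y\<in>X. 0 \<le> d x y) \<and>
     (\<forall>x\<in>X. d x x = 0) \<and>
     (\<forall>x\<in>X. \<forall>y\<in>X. d x y = d y x) \<and>
     (\<forall>x\<in>X. \<forall>y\<in>X. \<forall>z\<in>X. d x z \<le> d x y + d y z)"

definition totally_bounded_pseudo :: "'a set \<Rightarrow> ('a \<Rightarrow> 'a \<Rightarrow> real) \<Rightarrow> bool" where
  "totally_bounded_pseudo X d \<longleftrightarrow>
     (\<forall>\<epsilon>>0. \<exists>F. finite F \<and> F \<subseteq> X \<and> X \<subseteq> (\<Union>x\<in>F. {y\<in>X. d x y \<le> \<epsilon>}))"

text \<open>Maps on \<open>X\<close> are represented by functions that are \<^const>\<open>undefined\<close> outside \<open>X\<close>, as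
  in the library's sup-metric space \<^const>\<open>funspace\<close>.\<close>

definition nonexpansive_maps :: "'a set \<Rightarrow> ('a \<Rightarrow> 'a \<Rightarrow> real) \<Rightarrow> ('a \<Rightarrow> real) set" where
  "nonexpansive_maps X d =
     {f \<in> X \<rightarrow>\<^sub>E {0..1}. \<forall>x\<in>X. \<forall>y\<in>X. \<bar>f x - f y\<bar> \<le> d x y}"

definition nonexpansive_space :: "'a set \<Rightarrow> ('a \<Rightarrow> 'a \<Rightarrow> real) \<Rightarrow> ('a \<Rightarrow> real) metric" where
  "nonexpansive_space X d = submetric (funspace X euclidean_metric) (nonexpansive_maps X d)"

definition dense_subset :: "'a metric \<Rightarrow> 'a set \<Rightarrow> bool" where
  "dense_subset m S \<longleftrightarrow> S \<subseteq> mspace m \<and> mtopology_of m closure_of S = mspace m"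

definition discrete_dist :: "'a set \<Rightarrow> ('a \<Rightarrow> real) \<Rightarrow> bool" where
  "discrete_dist X \<pi> \<longleftrightarrow> (\<forall>x\<in>X. 0 \<le> \<pi> x) \<and> (\<pi> has_sum 1) X"

definition couplings :: "'a set \<Rightarrow> ('a \<Rightarrow> real) \<Rightarrow> ('a \<Rightarrow> real) \<Rightarrow> ('a \<times> 'a \<Rightarrow> real) set" where
  "couplings X \<pi>\<^sub>1 \<pi>\<^sub>2 =
     {\<mu>. discrete_dist (X \<times> X) \<mu> \<and>
         (\<forall>x\<in>X. ((\<lambda>y. \<mu> (x, y)) has_sum \<pi>\<^sub>1 x) X) \<and>
         (\<forall>y\<in>X. ((\<lambda>x. \<mu> (x, y)) has_sum \<pi>\<^sub>2 y) X)}"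

definition zero_on :: "'a set \<Rightarrow> ('a \<Rightarrow> real) \<Rightarrow> bool" where
  "zero_on X \<pi> \<longleftrightarrow> (\<forall>x\<in>X. \<pi> x = 0)"

definition kantorovich ::
  "'a set \<Rightarrow> ('a \<Rightarrow> 'a \<Rightarrow> real) \<Rightarrow> ('a \<Rightarrow> real) \<Rightarrow> ('a \<Rightarrow> real) \<Rightarrow> real" where
  "kantorovich X d \<pi>\<^sub>1 \<pi>\<^sub>2 =
     (if zero_on X \<pi>\<^sub>1 \<and> zero_on X \<pi>\<^sub>2 then 0
      else if zero_on X \<pi>\<^sub>1 \<or> zero_on X \<pi>\<^sub>2 then 1
      else (SUP f\<in>nonexpansive_maps X d. \<bar>expect X \<pi>\<^sub>1 f - expect X \<pi>\<^sub>2 f\<bar>))"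

definition wasserstein ::
  "'a set \<Rightarrow> ('a \<Rightarrow> 'a \<Rightarrow> real) \<Rightarrow> ('a \<Rightarrow> real) \<Rightarrow> ('a \<Rightarrow> real) \<Rightarrow> real" where
  "wasserstein X d \<pi>\<^sub>1 \<pi>\<^sub>2 =
     (if zero_on X \<pi>\<^sub>1 \<and> zero_on X \<pi>\<^sub>2 then 0
      else if zero_on X \<pi>\<^sub>1 \<or> zero_on X \<pi>\<^sub>2 then 1
      else (INF \<mu>\<in>couplings X \<pi>\<^sub>1 \<pi>\<^sub>2. expect (X \<times> X) \<mu> (\<lambda>(x, y). d x y)))"

text \<open>Inserting \<open>0\<close> makes the maximum \<open>0\<close> when there are no atomic concepts, and changes
  nothing otherwise.\<close>

definition atom_dist :: "'c set \<Rightarrow> ('s, 'c) model \<Rightarrow> 's \<Rightarrow> 's \<Rightarrow> real" where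
  "atom_dist NC I a b = Max (insert 0 ((\<lambda>A. \<bar>conc I A a - conc I A b\<bar>) ` NC))"

primrec dW :: "'c set \<Rightarrow> ('s, 'c) model \<Rightarrow> nat \<Rightarrow> 's \<Rightarrow> 's \<Rightarrow> real" where
  "dW NC I 0 = (\<lambda>a b. 0)"
| "dW NC I (Suc n) =
     (\<lambda>a b. max (atom_dist NC I a b) (wasserstein (states I) (dW NC I n) (role I a) (role I b)))"

primrec dK :: "'c set \<Rightarrow> ('s, 'c) model \<Rightarrow> nat \<Rightarrow> 's \<Rightarrow> 's \<Rightarrow> real" where
  "dK NC I 0 = (\<lambda>a b. 0)"
| "dK NC I (Suc n) =
     (\<lambda>a b. max (atom_dist NC I a b) (kantorovich (states I) (dK NC I n) (role I a) (role I b)))"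

definition dL :: "'c set \<Rightarrow> ('s, 'c) model \<Rightarrow> nat \<Rightarrow> 's \<Rightarrow> 's \<Rightarrow> real" where
  "dL NC I n a b = (SUP C\<in>{C. concept_over NC C \<and> rk C \<le> n}. \<bar>interp I C a - interp I C b\<bar>)"

text \<open>Both winning conditions hold when two blocking states disagree on an atomic concept by
  more than \<open>\<epsilon>\<close>; Spoiler's condition takes precedence then.\<close>

definition spoiler_wins_now :: "'c set \<Rightarrow> ('s, 'c) model \<Rightarrow> 's \<Rightarrow> 's \<Rightarrow> real \<Rightarrow> bool" where
  "spoiler_wins_now NC I a b \<epsilon> \<longleftrightarrow>
     (blocking I a \<noteq> blocking I b \<and> \<epsilon> < 1) \<or> (\<exists>A\<in>NC. \<bar>conc I A a - conc I A b\<bar> > \<epsilon>)"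

definition duplicator_wins_now :: "('s, 'c) model \<Rightarrow> 's \<Rightarrow> 's \<Rightarrow> real \<Rightarrow> bool" where
  "duplicator_wins_now I a b \<epsilon> \<longleftrightarrow> (blocking I a \<and> blocking I b) \<or> \<epsilon> = 1"

primrec duplicator_wins ::
  "'c set \<Rightarrow> ('s, 'c) model \<Rightarrow> nat \<Rightarrow> 's \<Rightarrow> 's \<Rightarrow> real \<Rightarrow> bool" where
  "duplicator_wins NC I 0 = (\<lambda>a b \<epsilon>. True)"
| "duplicator_wins NC I (Suc n) = (\<lambda>a b \<epsilon>.
     \<not> spoiler_wins_now NC I a b \<epsilon> \<and>
     (duplicator_wins_now I a b \<epsilon> \<or>
      (\<exists>\<mu>\<in>couplings (states I) (role I a) (role I b).
       \<exists>\<epsilon>'\<in>states I \<times> states I \<rightarrow> {0..1}.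
         expect (states I \<times> states I) \<mu> \<epsilon>' \<le> \<epsilon> \<and>
         (\<forall>a'\<in>states I. \<forall>b'\<in>states I. \<mu> (a', b') > 0 \<longrightarrow>
            duplicator_wins NC I n a' b' (\<epsilon>' (a', b'))))))"

definition dG :: "'c set \<Rightarrow> ('s, 'c) model \<Rightarrow> nat \<Rightarrow> 's \<Rightarrow> 's \<Rightarrow> real" where
  "dG NC I n a b = Inf {\<epsilon> \<in> {0..1}. duplicator_wins NC I n a b \<epsilon>}"

end

theory Submission
  imports Defs
begin

text \<open>The logical distance \<open>d\<^sup>L\<close> serves as the reference, and total boundedness carries the
  induction on \<open>n\<close>. If \<open>d\<^sup>L\<^sub>n\<close> is totally bounded, the concepts of rank at most \<open>n\<close> are dense in
  the non-expansive maps by a Stone-Weierstrass argument for lattices: any two values compatible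
  with \<open>d\<^sup>L\<^sub>n\<close> are interpolated by a concept, and finite minima and maxima over a net do the rest.
  Density turns the Kantorovich supremum into a supremum over concepts \<open>\<Diamond>C\<close>, so
  \<open>d\<^sup>L\<close> satisfies the recursion of \<open>d\<^sup>K\<close>; and since the non-expansive maps have finite nets
  in the supremum metric, the expectations of the finitely many maps of such a net show that
  \<open>d\<^sup>L\<^sub>n\<^sub>+\<^sub>1\<close> is totally bounded again. The Wasserstein distance enters through Kantorovich duality,
  which total boundedness reduces to finite spaces: there an optimal coupling exists by
  compactness, its support is cyclically monotone, and shortest alternating walks through the
  support define an optimal potential. In the game, Duplicator plays a nearly optimal coupling.\<close>

section \<open>Optimal transport on finite sets\<close>

definition fin_coupling :: "'a set \<Rightarrow> ('a \<Rightarrow> real) \<Rightarrow> ('a \<Rightarrow> real) \<Rightarrow> ('a \<times> 'a \<Rightarrow> real) \<Rightarrow> bool" where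
  "fin_coupling F p q \<mu> \<longleftrightarrow>
     (\<forall>x\<in>F. \<forall>y\<in>F. 0 \<le> \<mu> (x, y)) \<and>
     (\<forall>x\<in>F. (\<Sum>y\<in>F. \<mu> (x, y)) = p x) \<and> (\<forall>y\<in>F. (\<Sum>x\<in>F. \<mu> (x, y)) = q y)"

definition cost :: "'a set \<Rightarrow> ('a \<Rightarrow> 'a \<Rightarrow> real) \<Rightarrow> ('a \<times> 'a \<Rightarrow> real) \<Rightarrow> real" where
  "cost F c \<mu> = (\<Sum>x\<in>F. \<Sum>y\<in>F. \<mu> (x, y) * c x y)"

lemma fin_coupling_le:
  assumes "finite F" "fin_coupling F p q \<mu>" "x \<in> F" "y \<in> F"
  shows "\<mu> (x, y) \<le> p x" "\<mu> (x, y) \<le> q y"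
proof -
  have "\<mu> (x, y) \<le> (\<Sum>y\<in>F. \<mu> (x, y))"
    using assms by (intro member_le_sum) (auto simp: fin_coupling_def)
  then show "\<mu> (x, y) \<le> p x"
    using assms by (simp add: fin_coupling_def)
  have "\<mu> (x, y) \<le> (\<Sum>x\<in>F. \<mu> (x, y))"
    using assms by (intro member_le_sum[where f = "\<lambda>x. \<mu> (x, y)"]) (auto simp: fin_coupling_def)
  then show "\<mu> (x, y) \<le> q y"
    using assms by (simp add: fin_coupling_def)
qed

text \<open>Each entry of a coupling is bounded by a marginal, so the couplings form a closed subset
  of a product of compact intervals. By Tychonoff it is compact, and the cost, a finite linear
  combination of coordinates, is continuous for the product topology.\<close>

lemma optimal_fin_coupling_exists:
  fixes p q :: "'a \<Rightarrow> real"
  assumes F: "finite F" and p: "\<And>x. x \<in> F \<Longrightarrow> 0 \<le> p x" "sum p F = 1"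
    and q: "\<And>x. x \<in> F \<Longrightarrow> 0 \<le> q x" "sum q F = 1"
  obtains \<mu> where "fin_coupling F p q \<mu>"
    and "\<And>\<nu>. fin_coupling F p q \<nu> \<Longrightarrow> cost F c \<mu> \<le> cost F c \<nu>"
proof -
  \<comment> \<open>\<open>fin_coupling\<close> leaves the values off \<open>F \<times> F\<close>
    free. Fixing them to 0 gives compactness in the full function space and affects neither
    marginals nor cost.\<close>
  define S where "S z = (if z \<in> F \<times> F then {0..p (fst z)} else {0})" for z :: "'a \<times> 'a"
  define K where "K = PiE UNIV S \<inter> ((\<Inter>x\<in>F. {\<mu>. (\<Sum>y\<in>F. \<mu> (x, y)) = p x}) \<inter>
                         (\<Inter>y\<in>F. {\<mu>. (\<Sum>x\<in>F. \<mu> (x, y)) = q y}))"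
  have "compactin (product_topology (\<lambda>i. euclidean) UNIV) (PiE UNIV S)"
    by (subst compactin_PiE) (auto simp: S_def compactin_euclidean_iff)
  then have "compact (PiE UNIV S)"
    by (simp add: euclidean_product_topology compactin_euclidean_iff)
  moreover have "closed ((\<Inter>x\<in>F. {\<mu>::'a \<times> 'a \<Rightarrow> real. (\<Sum>y\<in>F. \<mu> (x, y)) = p x}) \<inter>
                         (\<Inter>y\<in>F. {\<mu>. (\<Sum>x\<in>F. \<mu> (x, y)) = q y}))"
    by (intro closed_Int closed_INT ballI closed_Collect_eq continuous_on_sum
        continuous_on_product_coordinates continuous_on_const)
  ultimately have "compact K"
    unfolding K_def by (rule compact_Int_closed)
  have restr: "(\<lambda>z. if z \<in> F \<times> F then \<nu> z else 0) \<in> K" if "fin_coupling F p q \<nu>" for \<nu>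
    using that fin_coupling_le[OF F that] unfolding K_def fin_coupling_def
    by (auto simp: S_def PiE_def)
  \<comment> \<open>The product coupling shows that the compact set is nonempty.\<close>
  have "fin_coupling F p q (\<lambda>(x, y). p x * q y)"
    using p q by (auto simp: fin_coupling_def simp flip: sum_distrib_left sum_distrib_right)
  then have "K \<noteq> {}" using restr by blast
  moreover have "continuous_on K (cost F c)"
    unfolding cost_def
    by (intro continuous_on_sum continuous_on_mult continuous_on_const
        continuous_on_subset[OF continuous_on_product_coordinates]) auto
  ultimately obtain \<mu> where \<mu>: "\<mu> \<in> K" "\<And>\<nu>. \<nu> \<in> K \<Longrightarrow> cost F c \<mu> \<le> cost F c \<nu>"
    using continuous_attains_inf[OF \<open>compact K\<close>] by metis
  show thesis
  proof
    have "0 \<le> \<mu> (x, y)" if "x \<in> F" "y \<in> F" for x y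
      using \<mu>(1) that unfolding K_def PiE_def Pi_def S_def by (force split: if_splits)
    then show "fin_coupling F p q \<mu>"
      using \<mu>(1) by (auto simp: fin_coupling_def K_def)
    fix \<nu> assume "fin_coupling F p q \<nu>"
    from \<mu>(2)[OF restr[OF this]] show "cost F c \<mu> \<le> cost F c \<nu>"
      by (simp add: cost_def)
  qed
qed

text \<open>A walk alternates between pairs of the support: from \<open>(x, y)\<close> it moves to a point \<open>v\<close>,
  which models rerouting mass from \<open>(x, y)\<close> to \<open>(v, y)\<close>. Walks are stored with the last
  pair first.\<close>

fun walk_weight :: "('a \<Rightarrow> 'a \<Rightarrow> real) \<Rightarrow> ('a \<times> 'a) list \<Rightarrow> 'a \<Rightarrow> real" where
  "walk_weight c [] v = 0"
| "walk_weight c ((x, y) # zs) v = walk_weight c zs x + c v y - c x y"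

text \<open>Signed change of a coupling when one unit of mass is rerouted along the walk.\<close>

fun walk_shift :: "('a \<times> 'a) list \<Rightarrow> 'a \<Rightarrow> 'a \<times> 'a \<Rightarrow> real" where
  "walk_shift [] v = (\<lambda>z. 0)"
| "walk_shift ((x, y) # zs) v =
     (\<lambda>z. walk_shift zs x z + of_bool (z = (v, y)) - of_bool (z = (x, y)))"

text \<open>The recursion runs from the end of the walk to its beginning; the walk is closed when
  the result equals its endpoint \<open>v\<close>.\<close>

fun walk_start :: "('a \<times> 'a) list \<Rightarrow> 'a \<Rightarrow> 'a" where
  "walk_start [] v = v"
| "walk_start ((x, y) # zs) v = walk_start zs x"

lemma walk_start_snoc: "walk_start (zs @ [(x, y)]) v = x"
  by (induction zs v rule: walk_start.induct) auto

lemma walk_shift_cost: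
  assumes "finite F" "set zs \<subseteq> F \<times> F" "v \<in> F"
  shows "cost F c (walk_shift zs v) = walk_weight c zs v"
  using assms(2,3)
proof (induction zs v rule: walk_start.induct)
  case (1 v)
  show ?case by (simp add: cost_def)
next
  case (2 x y zs v)
  have single: "(\<Sum>i\<in>F. \<Sum>j\<in>F. of_bool ((i, j) = (s, t)) * c i j) = c s t"
    if "s \<in> F" "t \<in> F" for s t
  proof -
    have "(\<Sum>i\<in>F. \<Sum>j\<in>F. of_bool ((i, j) = (s, t)) * c i j)
        = (\<Sum>i\<in>F. if i = s then \<Sum>j\<in>F. if j = t then c i j else 0 else 0)"
      by (intro sum.cong refl) (auto intro!: sum.cong)
    then show ?thesis using that assms(1) by simp
  qed
  have "cost F c (walk_shift ((x, y) # zs) v)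
      = cost F c (walk_shift zs x) + (\<Sum>i\<in>F. \<Sum>j\<in>F. of_bool ((i, j) = (v, y)) * c i j)
        - (\<Sum>i\<in>F. \<Sum>j\<in>F. of_bool ((i, j) = (x, y)) * c i j)"
    unfolding cost_def walk_shift.simps sum.distrib[symmetric] sum_subtractf[symmetric]
    by (intro sum.cong refl) (simp add: algebra_simps)
  then show ?case
    using 2 single by simp
qed

lemma sum_of_bool_Pair_left:
  assumes "finite F" "y \<in> F"
  shows "(\<Sum>j\<in>F. of_bool ((i, j) = (s, y))) = (of_bool (i = s) :: real)"
proof -
  have "(\<Sum>j\<in>F. of_bool ((i, j) = (s, y))) = (\<Sum>j\<in>F. if j = y then of_bool (i = s) else (0::real))"
    by (intro sum.cong) auto
  then show ?thesis using assms by (simp only: sum.delta if_True)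
qed

lemma sum_of_bool_Pair_right:
  assumes "finite F" "s \<in> F"
  shows "(\<Sum>i\<in>F. of_bool ((i, j) = (s, y))) = (of_bool (j = y) :: real)"
proof -
  have "(\<Sum>i\<in>F. of_bool ((i, j) = (s, y))) = (\<Sum>i\<in>F. if i = s then of_bool (j = y) else (0::real))"
    by (intro sum.cong) auto
  then show ?thesis using assms by (simp only: sum.delta if_True)
qed

text \<open>Every move transfers mass within one column, so column sums are unchanged; row sums
  telescope along the walk and only its two ends remain. A closed walk therefore preserves both
  marginals.\<close>

lemma walk_shift_marginals:
  assumes "finite F" "set zs \<subseteq> F \<times> F" "v \<in> F"
  shows "(\<Sum>j\<in>F. walk_shift zs v (i, j)) = of_bool (i = v) - of_bool (i = walk_start zs v)"
    and "(\<Sum>i\<in>F. walk_shift zs v (i, j)) = 0"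
  using assms(2,3)
  by (induction zs v rule: walk_start.induct)
    (simp_all add: sum.distrib sum_subtractf sum_of_bool_Pair_left sum_of_bool_Pair_right assms(1)
      del: prod.inject sum_of_bool_eq)

text \<open>Controls how much mass can be shifted before an entry of the coupling turns negative:
  only pairs on the walk lose mass, and each move takes at most one unit.\<close>

lemma walk_shift_lower:
  shows "- real (length zs) \<le> walk_shift zs v z"
    and "z \<notin> set zs \<Longrightarrow> 0 \<le> walk_shift zs v z"
  by (induction zs v rule: walk_start.induct) auto

text \<open>Cyclical monotonicity of the support: shifting a little mass along a closed walk yields
  another coupling, whose cost differs by a positive multiple of the weight of the walk, so a
  negative weight would contradict optimality.\<close>

lemma optimal_closed_walk_nonneg:
  assumes F: "finite F" and \<mu>: "fin_coupling F p q \<mu>"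
    and opt: "\<And>\<nu>. fin_coupling F p q \<nu> \<Longrightarrow> cost F c \<mu> \<le> cost F c \<nu>"
    and zs: "set zs \<subseteq> {z \<in> F \<times> F. 0 < \<mu> z}" and v: "v \<in> F" "walk_start zs v = v"
  shows "0 \<le> walk_weight c zs v"
proof -
  have zsF: "set zs \<subseteq> F \<times> F" using zs by auto
  \<comment> \<open>The inserted 1 keeps the minimum defined for the empty walk.\<close>
  define m where "m = Min (insert 1 (\<mu> ` set zs))"
  have m: "0 < m" "\<And>z. z \<in> set zs \<Longrightarrow> m \<le> \<mu> z"
    using zs by (auto simp: m_def)
  \<comment> \<open>The walk lowers an entry by at most its length, so with this amount no entry on
    it loses more than \<open>m\<close>; the summand 1 avoids division by zero.\<close>
  define \<delta> where "\<delta> = m / (real (length zs) + 1)"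
  have \<delta>: "0 < \<delta>" "\<delta> * real (length zs) \<le> m"
    using m(1) by (auto simp: \<delta>_def field_simps)
  define \<nu> where "\<nu> z = \<mu> z + \<delta> * walk_shift zs v z" for z
  have nonneg: "0 \<le> \<nu> z" if "z \<in> F \<times> F" for z
  proof (cases "z \<in> set zs")
    case True
    have "- (\<delta> * real (length zs)) \<le> \<delta> * walk_shift zs v z"
      using mult_left_mono[OF walk_shift_lower(1)[of zs v z], of \<delta>] \<delta>(1) by simp
    then show ?thesis
      using m(2)[OF True] \<delta>(2) by (simp add: \<nu>_def)
  next
    case False
    then show ?thesis
      using \<mu> that \<delta>(1) walk_shift_lower(2)[OF False, of v] by (auto simp: \<nu>_def fin_coupling_def)
  qed
  have "fin_coupling F p q \<nu>"
    using \<mu> nonneg walk_shift_marginals[OF F zsF v(1)] v(2)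
    unfolding fin_coupling_def \<nu>_def by (simp add: sum.distrib flip: sum_distrib_left)
  from opt[OF this] have "cost F c \<mu> \<le> cost F c \<nu>" .
  also have "cost F c \<nu> = cost F c \<mu> + \<delta> * cost F c (walk_shift zs v)"
    by (simp add: cost_def \<nu>_def sum_distrib_left sum.distrib algebra_simps)
  finally show ?thesis
    using walk_shift_cost[OF F zsF v(1)] \<delta>(1) by (simp add: zero_le_mult_iff)
qed

text \<open>Potentials as shortest-path distances: from a fixed base pair, take the infimum of the
  weights of all walks to a point. The absence of negative closed walks keeps it finite on the first
  projection of \<open>S\<close>, and extending walks by one pair gives the inequality.\<close>

lemma potential_exists:
  fixes c :: "'a \<Rightarrow> 'a \<Rightarrow> real"
  assumes closed: "\<And>zs v. set zs \<subseteq> S \<Longrightarrow> v \<in> fst ` S \<Longrightarrow> walk_start zs v = v \<Longrightarrow> 0 \<le> walk_weight c zs v"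
  obtains \<phi> where "\<And>x y x'. (x, y) \<in> S \<Longrightarrow> x' \<in> fst ` S \<Longrightarrow> \<phi> x' \<le> \<phi> x + c x' y - c x y"
proof (cases "S = {}")
  case True
  then show thesis using that by simp
next
  case False
  then obtain x0 y0 where s0: "(x0, y0) \<in> S" by auto
  \<comment> \<open>Walks are stored last pair first, so appending \<open>(x0, y0)\<close> fixes the
    beginning of the walk.\<close>
  define W where "W v = {walk_weight c (zs @ [(x0, y0)]) v | zs. set zs \<subseteq> S}" for v
  have bdd: "bdd_below (W v)" if vw: "(v, w) \<in> S" for v w
  proof (rule bdd_belowI)
    fix t assume "t \<in> W v"
    then obtain zs where zs: "set zs \<subseteq> S" "t = walk_weight c (zs @ [(x0, y0)]) v"
      by (auto simp: W_def)
    \<comment> \<open>Returning to \<open>x0\<close> through \<open>(v, w)\<close> closes the walk;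
      nonnegativity of its weight yields the lower bound.\<close>
    have "0 \<le> walk_weight c (((v, w) # zs) @ [(x0, y0)]) x0"
      using zs s0 vw by (intro closed) (auto simp: walk_start_snoc intro: rev_image_eqI)
    then show "c v w - c x0 w \<le> t" using zs by simp
  qed
  have "Inf (W x') \<le> Inf (W x) + c x' y - c x y" if xy: "(x, y) \<in> S" and x': "x' \<in> fst ` S" for x y x'
  proof -
    from x' obtain y' where y': "(x', y') \<in> S" by auto
    have "Inf (W x') - c x' y + c x y \<le> Inf (W x)"
    proof (rule cInf_greatest)
      show "W x \<noteq> {}" by (auto simp: W_def intro: exI[of _ "[]"])
      fix t assume "t \<in> W x"
      then obtain zs where zs: "set zs \<subseteq> S" "t = walk_weight c (zs @ [(x0, y0)]) x"
        by (auto simp: W_def)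
      \<comment> \<open>Any walk to \<open>x\<close> extends through \<open>(x, y)\<close> to
        \<open>x'\<close>, which compares the two infima.\<close>
      have "walk_weight c (((x, y) # zs) @ [(x0, y0)]) x' \<in> W x'"
        unfolding W_def using zs xy by (intro CollectI exI[of _ "(x, y) # zs"]) auto
      from cInf_lower[OF this bdd[OF y']] show "Inf (W x') - c x' y + c x y \<le> t"
        using zs by simp
    qed
    then show ?thesis by simp
  qed
  then show thesis using that[of "\<lambda>v. Inf (W v)"] by blast
qed

text \<open>The potential extends from the support to all of \<open>X\<close> as a minimum of
  finitely many functions that are 1-Lipschitz for \<open>d\<close>. Across each pair of the support
  it drops by exactly \<open>d x y\<close>, so the cost of the optimal coupling becomes a difference
  of expectations (complementary slackness). The values of \<open>f\<close> are moved into the unit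
  interval only later.\<close>

lemma finite_duality:
  fixes d :: "'a \<Rightarrow> 'a \<Rightarrow> real"
  assumes d: "pseudometric_on X d" and F: "finite F" "F \<subseteq> X"
    and p: "\<And>x. x \<in> F \<Longrightarrow> 0 \<le> p x" "sum p F = 1"
    and q: "\<And>x. x \<in> F \<Longrightarrow> 0 \<le> q x" "sum q F = 1"
  obtains \<mu> f where "fin_coupling F p q \<mu>"
    and "\<And>x y. x \<in> X \<Longrightarrow> y \<in> X \<Longrightarrow> \<bar>f x - f y\<bar> \<le> d x y"
    and "cost F d \<mu> = (\<Sum>x\<in>F. p x * f x) - (\<Sum>x\<in>F. q x * f x)"
proof -
  obtain \<mu> where \<mu>: "fin_coupling F p q \<mu>"
    and opt: "\<And>\<nu>. fin_coupling F p q \<nu> \<Longrightarrow> cost F d \<mu> \<le> cost F d \<nu>"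
    using optimal_fin_coupling_exists[OF F(1) p q] by metis
  define S where "S = {z \<in> F \<times> F. 0 < \<mu> z}"
  have "finite S" using F by (auto simp: S_def)
  \<comment> \<open>Total mass 1 forces a nonempty support, which the minimum defining
    \<open>f\<close> requires.\<close>
  have "S \<noteq> {}"
  proof
    assume "S = {}"
    have "\<mu> (x, y) = 0" if "x \<in> F" "y \<in> F" for x y
    proof -
      have "\<not> 0 < \<mu> (x, y)" using \<open>S = {}\<close> that unfolding S_def by blast
      then show ?thesis using \<mu> that by (simp add: fin_coupling_def order_antisym)
    qed
    then have "p x = 0" if "x \<in> F" for x
      using \<mu> that by (simp add: fin_coupling_def)
    then show False using p by simp
  qed
  obtain \<phi> where \<phi>: "\<And>x y x'. (x, y) \<in> S \<Longrightarrow> x' \<in> fst ` S \<Longrightarrow> \<phi> x' \<le> \<phi> x + d x' y - d x y"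
  proof (rule potential_exists)
    show "0 \<le> walk_weight d zs v"
      if "set zs \<subseteq> S" "v \<in> fst ` S" "walk_start zs v = v" for zs v
      using that by (intro optimal_closed_walk_nonneg[OF F(1) \<mu> opt]) (auto simp: S_def)
  qed metis
  define f where "f z = Min ((\<lambda>(x, y). \<phi> x - d x y + d z y) ` S)" for z
  have f_le: "f z \<le> \<phi> x - d x y + d z y" if "(x, y) \<in> S" for x y z
    unfolding f_def using \<open>finite S\<close> that by (intro Min_le) force+
  have f_ge: "t \<le> f z" if "\<And>x y. (x, y) \<in> S \<Longrightarrow> t \<le> \<phi> x - d x y + d z y" for t z
    unfolding f_def using \<open>finite S\<close> \<open>S \<noteq> {}\<close> that by (subst Min_ge_iff) auto
  have SX: "x \<in> F \<and> y \<in> F \<and> x \<in> X \<and> y \<in> X" if "(x, y) \<in> S" for x y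
    using that F by (auto simp: S_def)
  have "f a - d a b \<le> f b" if "a \<in> X" "b \<in> X" for a b
  proof (rule f_ge)
    fix x y assume "(x, y) \<in> S"
    moreover have "d a y \<le> d a b + d b y"
      using d that SX[OF \<open>(x, y) \<in> S\<close>] unfolding pseudometric_on_def by blast
    ultimately show "f a - d a b \<le> \<phi> x - d x y + d b y"
      using f_le[of x y a] by simp
  qed
  moreover have "d a b = d b a" if "a \<in> X" "b \<in> X" for a b
    using d that by (auto simp: pseudometric_on_def)
  ultimately have lip: "\<bar>f a - f b\<bar> \<le> d a b" if "a \<in> X" "b \<in> X" for a b
    using that by (smt (verit))
  \<comment> \<open>The potential inequality gives \<open>\<phi> x \<le> f x\<close>; the pair
    \<open>(x, y)\<close> itself, evaluated at \<open>y\<close>, gives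
    \<open>f y \<le> \<phi> x - d x y\<close>. The reverse bound is the Lipschitz property.\<close>
  have tight: "f x - f y = d x y" if "(x, y) \<in> S" for x y
  proof -
    have "\<phi> x \<le> f x"
    proof (rule f_ge)
      fix x' y' assume "(x', y') \<in> S"
      then show "\<phi> x \<le> \<phi> x' - d x' y' + d x y'"
        using \<phi>[of x' y' x] that by (force simp: algebra_simps)
    qed
    moreover have "d y y = 0" using d SX[OF that] by (auto simp: pseudometric_on_def)
    then have "f y \<le> \<phi> x - d x y" using f_le[OF that, of y] by simp
    ultimately show ?thesis using lip[of x y] SX[OF that] by auto
  qed
  have "cost F d \<mu> = (\<Sum>x\<in>F. \<Sum>y\<in>F. \<mu> (x, y) * (f x - f y))"
    unfolding cost_def
  proof (intro sum.cong refl)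
    fix x y assume "x \<in> F" "y \<in> F"
    then have "(x, y) \<in> S \<or> \<mu> (x, y) = 0"
      using \<mu> unfolding S_def fin_coupling_def by (simp add: less_le)
    then show "\<mu> (x, y) * d x y = \<mu> (x, y) * (f x - f y)"
      using tight by auto
  qed
  also have "\<dots> = (\<Sum>x\<in>F. (\<Sum>y\<in>F. \<mu> (x, y)) * f x) - (\<Sum>y\<in>F. (\<Sum>x\<in>F. \<mu> (x, y)) * f y)"
    unfolding right_diff_distrib sum_subtractf sum_distrib_right
    using sum.swap[of "\<lambda>x y. \<mu> (x, y) * f y" F F] by simp
  also have "\<dots> = (\<Sum>x\<in>F. p x * f x) - (\<Sum>x\<in>F. q x * f x)"
    using \<mu> by (simp add: fin_coupling_def)
  finally show thesis using that[OF \<mu> lip] by blast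
qed

section \<open>Kantorovich duality on totally bounded spaces\<close>

lemma discrete_dist_summable_mult:
  assumes "discrete_dist X \<pi>" "\<And>x. x \<in> X \<Longrightarrow> \<bar>f x\<bar> \<le> B"
  shows "(\<lambda>x. \<pi> x * f x) summable_on X"
proof -
  have nonneg: "0 \<le> \<pi> x" if "x \<in> X" for x
    using assms(1) that by (auto simp: discrete_dist_def)
  have "\<pi> summable_on X"
    using assms(1) by (auto simp: discrete_dist_def summable_on_def)
  then have "(\<lambda>x. norm (\<pi> x * B)) summable_on X"
    by (subst summable_on_iff_abs_summable_on_real[symmetric]) (rule summable_on_cmult_left)
  then have "(\<lambda>x. norm (\<pi> x * f x)) summable_on X"
  proof (rule Infinite_Sum.abs_summable_on_comparison_test)
    fix x assume "x \<in> X"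
    then show "norm (\<pi> x * f x) \<le> norm (\<pi> x * B)"
      using nonneg[of x] assms(2)[of x] by (simp add: abs_mult mult_left_mono)
  qed
  then show ?thesis by (rule abs_summable_summable)
qed

lemma has_sum_expect:
  assumes "discrete_dist X \<pi>" "\<And>x. x \<in> X \<Longrightarrow> \<bar>f x\<bar> \<le> B"
  shows "((\<lambda>x. \<pi> x * f x) has_sum expect X \<pi> f) X"
  unfolding expect_def using discrete_dist_summable_mult[OF assms] by simp

lemma expect_cong:
  assumes "\<And>x. x \<in> X \<Longrightarrow> f x = g x"
  shows "expect X \<pi> f = expect X \<pi> g"
  unfolding expect_def using assms by (simp cong: infsum_cong)

lemma expect_const:
  assumes "discrete_dist X \<pi>"
  shows "expect X \<pi> (\<lambda>x. c) = c"
  using has_sum_cmult_left[where f = \<pi> and a = 1 and A = X and c = c] assms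
  by (simp add: discrete_dist_def expect_def infsumI)

lemma expect_add:
  assumes "discrete_dist X \<pi>" "\<And>x. x \<in> X \<Longrightarrow> \<bar>f x\<bar> \<le> B" "\<And>x. x \<in> X \<Longrightarrow> \<bar>g x\<bar> \<le> C"
  shows "expect X \<pi> (\<lambda>x. f x + g x) = expect X \<pi> f + expect X \<pi> g"
  using infsum_add[OF discrete_dist_summable_mult[OF assms(1,2)] discrete_dist_summable_mult[OF assms(1,3)]]
  by (simp add: expect_def distrib_left)

text \<open>Points of mass zero contribute nothing, so the comparison is required on the support
  only. The game needs this: Duplicator's win is known only at pairs of positive mass.\<close>

lemma expect_mono:
  assumes \<pi>: "discrete_dist X \<pi>" and "\<And>x. x \<in> X \<Longrightarrow> \<bar>f x\<bar> \<le> B" "\<And>x. x \<in> X \<Longrightarrow> \<bar>g x\<bar> \<le> C"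
    and le: "\<And>x. x \<in> X \<Longrightarrow> 0 < \<pi> x \<Longrightarrow> f x \<le> g x"
  shows "expect X \<pi> f \<le> expect X \<pi> g"
proof (rule has_sum_mono)
  show "((\<lambda>x. \<pi> x * f x) has_sum expect X \<pi> f) X" "((\<lambda>x. \<pi> x * g x) has_sum expect X \<pi> g) X"
    by (rule has_sum_expect[OF \<pi>]; fact)+
  fix x assume x: "x \<in> X"
  then have "0 \<le> \<pi> x" using \<pi> by (auto simp: discrete_dist_def)
  with le[OF x] show "\<pi> x * f x \<le> \<pi> x * g x"
    by (cases "\<pi> x = 0") (auto intro: mult_left_mono)
qed

lemma expect_in_unit_interval:
  assumes "discrete_dist X \<pi>" "\<And>x. x \<in> X \<Longrightarrow> f x \<in> {0..1}"
  shows "expect X \<pi> f \<in> {0..1}"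
proof -
  have b: "\<bar>f x\<bar> \<le> 1" if "x \<in> X" for x using assms(2)[OF that] by simp
  have "expect X \<pi> (\<lambda>x. 0) \<le> expect X \<pi> f" "expect X \<pi> f \<le> expect X \<pi> (\<lambda>x. 1)"
    using assms b by (auto intro!: expect_mono[where B = 1 and C = 1])
  then show ?thesis using expect_const[OF assms(1)] by simp
qed

lemma expect_diff_le:
  assumes \<pi>: "discrete_dist X \<pi>" and f: "\<And>x. x \<in> X \<Longrightarrow> \<bar>f x\<bar> \<le> B" and g: "\<And>x. x \<in> X \<Longrightarrow> \<bar>g x\<bar> \<le> C"
    and e: "\<And>x. x \<in> X \<Longrightarrow> \<bar>f x - g x\<bar> \<le> e"
  shows "\<bar>expect X \<pi> f - expect X \<pi> g\<bar> \<le> e"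
proof -
  have "expect X \<pi> f \<le> expect X \<pi> (\<lambda>x. g x + e)"
    using f g e by (intro expect_mono[OF \<pi>, where B = B and C = "C + \<bar>e\<bar>"]) (force simp: abs_le_iff)+
  moreover have "expect X \<pi> g \<le> expect X \<pi> (\<lambda>x. f x + e)"
    using f g e by (intro expect_mono[OF \<pi>, where B = C and C = "B + \<bar>e\<bar>"]) (force simp: abs_le_iff)+
  moreover have "expect X \<pi> (\<lambda>x. g x + e) = expect X \<pi> g + e"
    using expect_add[OF \<pi> g, where g = "\<lambda>_. e" and C = "\<bar>e\<bar>"] expect_const[OF \<pi>] by simp
  moreover have "expect X \<pi> (\<lambda>x. f x + e) = expect X \<pi> f + e"
    using expect_add[OF \<pi> f, where g = "\<lambda>_. e" and C = "\<bar>e\<bar>"] expect_const[OF \<pi>] by simp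
  ultimately show ?thesis by linarith
qed

lemma discrete_dist_not_zero_on:
  assumes "discrete_dist X \<pi>"
  shows "\<not> zero_on X \<pi>"
proof
  assume "zero_on X \<pi>"
  then have "(\<pi> has_sum 0) X" by (intro has_sum_0) (auto simp: zero_on_def)
  then show False using assms has_sum_unique[where f = \<pi> and A = X and x = 0 and y = 1] by (auto simp: discrete_dist_def)
qed

lemma expect_coupling_fst:
  assumes \<mu>: "\<mu> \<in> couplings X \<pi>\<^sub>1 \<pi>\<^sub>2" and f: "\<And>x. x \<in> X \<Longrightarrow> \<bar>f x\<bar> \<le> B"
  shows "expect (X \<times> X) \<mu> (\<lambda>(x, y). f x) = expect X \<pi>\<^sub>1 f"
proof -
  have "discrete_dist (X \<times> X) \<mu>" using \<mu> by (simp add: couplings_def)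
  then have "((\<lambda>z. \<mu> z * (case z of (x, y) \<Rightarrow> f x)) has_sum expect (X \<times> X) \<mu> (\<lambda>(x, y). f x)) (X \<times> X)"
    using f by (intro has_sum_expect) auto
  then have "((\<lambda>x. \<pi>\<^sub>1 x * f x) has_sum expect (X \<times> X) \<mu> (\<lambda>(x, y). f x)) X"
    using \<mu> by (rule_tac has_sum_SigmaD) (auto simp: couplings_def intro: has_sum_cmult_left)
  then show ?thesis by (simp add: expect_def infsumI)
qed

lemma expect_coupling_snd:
  assumes \<mu>: "\<mu> \<in> couplings X \<pi>\<^sub>1 \<pi>\<^sub>2" and f: "\<And>x. x \<in> X \<Longrightarrow> \<bar>f x\<bar> \<le> B"
  shows "expect (X \<times> X) \<mu> (\<lambda>(x, y). f y) = expect X \<pi>\<^sub>2 f"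
proof -
  have "discrete_dist (X \<times> X) \<mu>" using \<mu> by (simp add: couplings_def)
  then have "((\<lambda>z. \<mu> z * (case z of (x, y) \<Rightarrow> f y)) has_sum expect (X \<times> X) \<mu> (\<lambda>(x, y). f y)) (X \<times> X)"
    using f by (intro has_sum_expect) auto
  then have "((\<lambda>(y, x). \<mu> (x, y) * f y) has_sum expect (X \<times> X) \<mu> (\<lambda>(x, y). f y)) (X \<times> X)"
    by (subst (asm) has_sum_swap) (simp add: case_prod_unfold)
  then have "((\<lambda>y. \<pi>\<^sub>2 y * f y) has_sum expect (X \<times> X) \<mu> (\<lambda>(x, y). f y)) X"
    using \<mu> by (rule_tac has_sum_SigmaD) (auto simp: couplings_def intro: has_sum_cmult_left)
  then show ?thesis by (simp add: expect_def infsumI)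
qed

text \<open>The easy half of duality: integrate \<open>f x \<le> d x y + f y\<close> against
  \<open>\<mu>\<close>. Only one sign is treated and \<open>f\<close> may be negative, so that the
  result applies to both \<open>f\<close> and \<open>- f\<close>.\<close>

lemma expect_diff_le_coupling:
  assumes \<mu>: "\<mu> \<in> couplings X \<pi>\<^sub>1 \<pi>\<^sub>2" and f: "\<And>x. x \<in> X \<Longrightarrow> \<bar>f x\<bar> \<le> B"
    and lip: "\<And>x y. x \<in> X \<Longrightarrow> y \<in> X \<Longrightarrow> f x - f y \<le> d x y"
    and d: "\<And>x y. x \<in> X \<Longrightarrow> y \<in> X \<Longrightarrow> \<bar>d x y\<bar> \<le> C"
  shows "expect X \<pi>\<^sub>1 f - expect X \<pi>\<^sub>2 f \<le> expect (X \<times> X) \<mu> (\<lambda>(x, y). d x y)"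
proof -
  have dd: "discrete_dist (X \<times> X) \<mu>" using \<mu> by (simp add: couplings_def)
  have "expect (X \<times> X) \<mu> (\<lambda>(x, y). f x) \<le> expect (X \<times> X) \<mu> (\<lambda>z. (\<lambda>(x, y). d x y) z + (\<lambda>(x, y). f y) z)"
  proof (rule expect_mono[OF dd, where B = B and C = "C + B"])
    fix z assume "z \<in> X \<times> X"
    then obtain x y where z: "z = (x, y)" "x \<in> X" "y \<in> X" by auto
    show "\<bar>case z of (x, y) \<Rightarrow> f x\<bar> \<le> B" using f z by simp
    show "\<bar>(case z of (x, y) \<Rightarrow> d x y) + (case z of (x, y) \<Rightarrow> f y)\<bar> \<le> C + B"
      using f[of y] d[of x y] z by simp
    show "(case z of (x, y) \<Rightarrow> f x) \<le> (case z of (x, y) \<Rightarrow> d x y) + (case z of (x, y) \<Rightarrow> f y)"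
      using lip[of x y] z by simp
  qed
  also have "\<dots> = expect (X \<times> X) \<mu> (\<lambda>(x, y). d x y) + expect (X \<times> X) \<mu> (\<lambda>(x, y). f y)"
    using f d by (intro expect_add[OF dd, where B = C and C = B]) auto
  finally show ?thesis
    using expect_coupling_fst[OF \<mu> f] expect_coupling_snd[OF \<mu> f] by simp
qed

text \<open>When a function factors through a map \<open>g\<close> with finite range, its infinite
  sum against \<open>\<pi>\<close> becomes a finite one over the fibre masses, that is, over the
  push-forward of \<open>\<pi>\<close>.\<close>

lemma has_sum_fibres:
  assumes "finite F" "g ` X \<subseteq> F" "\<pi> summable_on X"
  shows "((\<lambda>x. \<pi> x * h (g x)) has_sum (\<Sum>u\<in>F. (\<Sum>\<^sub>\<infinity>x\<in>{x\<in>X. g x = u}. \<pi> x) * (h u :: real))) X"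
proof -
  have X: "(\<Union>u\<in>F. {x\<in>X. g x = u}) = X" using assms(2) by auto
  have "((\<lambda>x. \<pi> x * h (g x)) has_sum (\<Sum>u\<in>F. (\<Sum>\<^sub>\<infinity>x\<in>{x\<in>X. g x = u}. \<pi> x) * h u))
      (\<Union>u\<in>F. {x\<in>X. g x = u})"
  proof (rule sum_has_sum[OF assms(1)])
    fix u assume "u \<in> F"
    have "\<pi> summable_on {x\<in>X. g x = u}"
      using assms(3) by (rule summable_on_subset_banach) auto
    then have "((\<lambda>x. \<pi> x * h u) has_sum (\<Sum>\<^sub>\<infinity>x\<in>{x\<in>X. g x = u}. \<pi> x) * h u) {x\<in>X. g x = u}"
      by (intro has_sum_cmult_left) simp
    then show "((\<lambda>x. \<pi> x * h (g x)) has_sum (\<Sum>\<^sub>\<infinity>x\<in>{x\<in>X. g x = u}. \<pi> x) * h u) {x\<in>X. g x = u}"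
      by (subst has_sum_cong[where g = "\<lambda>x. \<pi> x * h u"]) auto
  qed auto
  then show ?thesis by (simp only: X)
qed

lemma fibre_mass_nonneg:
  assumes "discrete_dist X \<pi>"
  shows "0 \<le> (\<Sum>\<^sub>\<infinity>x\<in>{x\<in>X. g x = u}. \<pi> x)"
  using assms by (auto simp: discrete_dist_def intro: infsum_nonneg)

text \<open>Justifies division by fibre masses in the lifted coupling: a fibre of mass zero has no
  mass to distribute.\<close>

lemma fibre_mass_zero:
  assumes "discrete_dist X \<pi>" "(\<Sum>\<^sub>\<infinity>x\<in>{x\<in>X. g x = u}. \<pi> x) = 0" "x \<in> X" "g x = u"
  shows "\<pi> x = 0"
proof (rule nonneg_infsum_le_0D[where A = "{x\<in>X. g x = u}"])
  have "\<pi> summable_on X" using assms(1) by (auto simp: discrete_dist_def summable_on_def)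
  then show "\<pi> summable_on {x\<in>X. g x = u}"
    by (rule summable_on_subset_banach) auto
qed (use assms in \<open>auto simp: discrete_dist_def\<close>)

text \<open>A coupling \<open>\<nu>\<close> of the push-forwards along \<open>g\<close> lifts to a coupling of the original
  distributions that is a product measure on each block \<open>g x = u, g y = v\<close>.\<close>

lemma lift_fin_coupling:
  fixes \<pi>\<^sub>1 \<pi>\<^sub>2 :: "'a \<Rightarrow> real"
  assumes \<pi>: "discrete_dist X \<pi>\<^sub>1" "discrete_dist X \<pi>\<^sub>2" and F: "finite F" "g ` X \<subseteq> F"
    and P: "\<And>u. P u = (\<Sum>\<^sub>\<infinity>x\<in>{x\<in>X. g x = u}. \<pi>\<^sub>1 x)"
    and Q: "\<And>u. Q u = (\<Sum>\<^sub>\<infinity>x\<in>{x\<in>X. g x = u}. \<pi>\<^sub>2 x)"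
    and \<nu>: "fin_coupling F P Q \<nu>"
  obtains \<mu> where "\<mu> \<in> couplings X \<pi>\<^sub>1 \<pi>\<^sub>2"
    and "\<And>k. (\<And>u v. u \<in> F \<Longrightarrow> v \<in> F \<Longrightarrow> 0 \<le> k u v) \<Longrightarrow>
           expect (X \<times> X) \<mu> (\<lambda>(x, y). k (g x) (g y)) = cost F k \<nu>"
proof -
  \<comment> \<open>Within its fibre a point is drawn by the conditional distribution,
    \<open>\<pi>\<^sub>1 x / P (g x)\<close>. Where a fibre mass is 0, division yields 0, which is
    right since both the points and the matching entries of \<open>\<nu>\<close> then have mass
    0.\<close>
  define \<mu> where "\<mu> = (\<lambda>(x, y). (\<pi>\<^sub>1 x / P (g x)) * (\<pi>\<^sub>2 y / Q (g y)) * \<nu> (g x, g y))"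
  have summ: "\<pi>\<^sub>1 summable_on X" "\<pi>\<^sub>2 summable_on X"
    using \<pi> by (auto simp: discrete_dist_def summable_on_def)
  have PQ: "0 \<le> P u" "0 \<le> Q u" for u
    using fibre_mass_nonneg \<pi> P Q by metis+
  have PQ0: "P (g x) = 0 \<Longrightarrow> \<pi>\<^sub>1 x = 0" "Q (g x) = 0 \<Longrightarrow> \<pi>\<^sub>2 x = 0" if "x \<in> X" for x
    using fibre_mass_zero[OF \<pi>(1) _ that refl, of g] fibre_mass_zero[OF \<pi>(2) _ that refl, of g]
    unfolding P Q by blast+
  have \<nu>0: "P u = 0 \<Longrightarrow> \<nu> (u, v) = 0" "Q v = 0 \<Longrightarrow> \<nu> (u, v) = 0" if "u \<in> F" "v \<in> F" for u v
    using fin_coupling_le[OF F(1) \<nu> that] \<nu> that by (auto simp: fin_coupling_def order_antisym)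
  have gF: "g x \<in> F" if "x \<in> X" for x using F that by auto
  have nonneg: "0 \<le> \<mu> (x, y)" if "x \<in> X" "y \<in> X" for x y
    using \<pi> PQ \<nu> gF that by (auto simp: \<mu>_def discrete_dist_def fin_coupling_def)
  \<comment> \<open>The factor \<open>k\<close> serves two purposes: the constant 1 gives the first
    marginal, a general \<open>k\<close> gives the inner sum of the cost.\<close>
  have row: "((\<lambda>y. \<mu> (x, y) * k (g x) (g y)) has_sum \<pi>\<^sub>1 x * ((\<Sum>v\<in>F. \<nu> (g x, v) * k (g x) v) / P (g x))) X"
    if "x \<in> X" for x k
  proof -
    have "((\<lambda>y. \<pi>\<^sub>1 x / P (g x) * (\<pi>\<^sub>2 y * (\<nu> (g x, g y) * k (g x) (g y) / Q (g y)))) has_sum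
        \<pi>\<^sub>1 x / P (g x) * (\<Sum>v\<in>F. Q v * (\<nu> (g x, v) * k (g x) v / Q v))) X"
      unfolding Q by (intro has_sum_cmult_right has_sum_fibres[OF F summ(2)])
    moreover have "(\<Sum>v\<in>F. Q v * (\<nu> (g x, v) * k (g x) v / Q v)) = (\<Sum>v\<in>F. \<nu> (g x, v) * k (g x) v)"
      using \<nu>0(2)[OF gF[OF that]] by (intro sum.cong) auto
    ultimately show ?thesis by (simp add: \<mu>_def mult_ac)
  qed
  have col: "((\<lambda>x. \<mu> (x, y)) has_sum \<pi>\<^sub>2 y) X" if "y \<in> X" for y
  proof -
    have "((\<lambda>x. \<pi>\<^sub>2 y / Q (g y) * (\<pi>\<^sub>1 x * (\<nu> (g x, g y) / P (g x)))) has_sum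
        \<pi>\<^sub>2 y / Q (g y) * (\<Sum>u\<in>F. P u * (\<nu> (u, g y) / P u))) X"
      unfolding P by (intro has_sum_cmult_right has_sum_fibres[OF F summ(1)])
    moreover have "(\<Sum>u\<in>F. P u * (\<nu> (u, g y) / P u)) = (\<Sum>u\<in>F. \<nu> (u, g y))"
      using \<nu>0(1)[OF _ gF[OF that]] by (intro sum.cong) auto
    moreover have "(\<Sum>u\<in>F. \<nu> (u, g y)) = Q (g y)"
      using \<nu> gF[OF that] by (simp add: fin_coupling_def)
    ultimately show ?thesis using PQ0(2)[OF that] by (cases "Q (g y) = 0") (simp_all add: \<mu>_def mult_ac)
  qed
  have row1: "((\<lambda>y. \<mu> (x, y)) has_sum \<pi>\<^sub>1 x) X" if "x \<in> X" for x
    using row[OF that, of "\<lambda>_ _. 1"] \<nu> gF[OF that] PQ0(1)[OF that]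
    by (cases "P (g x) = 0") (simp_all add: fin_coupling_def)
  \<comment> \<open>Nonnegativity of \<open>k\<close> lets summability over the product be deduced
    from the iterated sums.\<close>
  have total: "((\<lambda>z. \<mu> z * (case z of (x, y) \<Rightarrow> k (g x) (g y))) has_sum cost F k \<nu>) (X \<times> X)"
    if k: "\<And>u v. u \<in> F \<Longrightarrow> v \<in> F \<Longrightarrow> 0 \<le> k u v" for k
  proof (rule has_sum_SigmaI)
    have "((\<lambda>x. \<pi>\<^sub>1 x * ((\<Sum>v\<in>F. \<nu> (g x, v) * k (g x) v) / P (g x))) has_sum
        (\<Sum>u\<in>F. P u * ((\<Sum>v\<in>F. \<nu> (u, v) * k u v) / P u))) X"
      unfolding P by (rule has_sum_fibres[OF F summ(1)])
    moreover have "(\<Sum>u\<in>F. P u * ((\<Sum>v\<in>F. \<nu> (u, v) * k u v) / P u)) = cost F k \<nu>"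
      unfolding cost_def
    proof (rule sum.cong)
      show "P u * ((\<Sum>v\<in>F. \<nu> (u, v) * k u v) / P u) = (\<Sum>v\<in>F. \<nu> (u, v) * k u v)" if "u \<in> F" for u
        using \<nu>0(1)[OF that] by (cases "P u = 0") auto
    qed simp
    ultimately show s: "((\<lambda>x. \<pi>\<^sub>1 x * ((\<Sum>v\<in>F. \<nu> (g x, v) * k (g x) v) / P (g x))) has_sum cost F k \<nu>) X"
      by simp
    show r: "((\<lambda>y. \<mu> (x, y) * (case (x, y) of (x, y) \<Rightarrow> k (g x) (g y))) has_sum
        \<pi>\<^sub>1 x * ((\<Sum>v\<in>F. \<nu> (g x, v) * k (g x) v) / P (g x))) X" if "x \<in> X" for x
      using row[OF that] by simp
    show "(\<lambda>z. \<mu> z * (case z of (x, y) \<Rightarrow> k (g x) (g y))) summable_on (X \<times> X)"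
      using r has_sum_imp_summable[OF s] by (rule summable_on_SigmaI) (use k nonneg gF in auto)
  qed
  have "cost F (\<lambda>_ _. 1) \<nu> = sum P F"
    using \<nu> by (simp add: cost_def fin_coupling_def)
  also have "\<dots> = 1"
    using has_sum_unique[OF has_sum_fibres[OF F summ(1), of "\<lambda>_. 1"], of 1] \<pi>(1)
    by (simp add: discrete_dist_def P)
  finally have "(\<mu> has_sum 1) (X \<times> X)"
    using total[of "\<lambda>_ _. 1"] by (simp add: case_prod_unfold)
  then have "\<mu> \<in> couplings X \<pi>\<^sub>1 \<pi>\<^sub>2"
    using nonneg row1 col by (auto simp: couplings_def discrete_dist_def)
  moreover have "expect (X \<times> X) \<mu> (\<lambda>(x, y). k (g x) (g y)) = cost F k \<nu>"
    if "\<And>u v. u \<in> F \<Longrightarrow> v \<in> F \<Longrightarrow> 0 \<le> k u v" for k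
    unfolding expect_def using that by (intro infsumI total)
  ultimately show thesis using that by blast
qed

lemma couplings_nonempty:
  assumes "discrete_dist X \<pi>\<^sub>1" "discrete_dist X \<pi>\<^sub>2"
  shows "couplings X \<pi>\<^sub>1 \<pi>\<^sub>2 \<noteq> {}"
proof -
  define \<mu> where "\<mu> = (\<lambda>(x, y). \<pi>\<^sub>1 x * \<pi>\<^sub>2 y)"
  have row: "((\<lambda>y. \<mu> (x, y)) has_sum \<pi>\<^sub>1 x) X" for x
    using has_sum_cmult_right[where f = \<pi>\<^sub>2 and a = 1 and A = X and c = "\<pi>\<^sub>1 x"] assms by (simp add: \<mu>_def discrete_dist_def)
  have col: "((\<lambda>x. \<mu> (x, y)) has_sum \<pi>\<^sub>2 y) X" for y
    using has_sum_cmult_left[where f = \<pi>\<^sub>1 and a = 1 and A = X and c = "\<pi>\<^sub>2 y"] assms by (simp add: \<mu>_def discrete_dist_def)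
  have nonneg: "0 \<le> \<mu> (x, y)" if "x \<in> X" "y \<in> X" for x y
    using assms that by (simp add: \<mu>_def discrete_dist_def)
  have "(\<pi>\<^sub>1 has_sum 1) X" using assms by (simp add: discrete_dist_def)
  moreover have "\<mu> summable_on X \<times> X"
    using row has_sum_imp_summable[OF calculation] by (rule summable_on_SigmaI) (use nonneg in auto)
  ultimately have "(\<mu> has_sum 1) (X \<times> X)"
    using row by (intro has_sum_SigmaI) auto
  then have "\<mu> \<in> couplings X \<pi>\<^sub>1 \<pi>\<^sub>2"
    using nonneg row col by (auto simp: couplings_def discrete_dist_def)
  then show ?thesis by blast
qed

section \<open>Bounds on the two liftings and their equality\<close>

lemma nonexpansive_mapsD:
  assumes "f \<in> nonexpansive_maps X d"
  shows "x \<in> X \<Longrightarrow> f x \<in> {0..1}" "x \<in> X \<Longrightarrow> y \<in> X \<Longrightarrow> \<bar>f x - f y\<bar> \<le> d x y"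
    "x \<in> X \<Longrightarrow> \<bar>f x\<bar> \<le> 1"
  using assms by (force simp: nonexpansive_maps_def)+

lemma nonexpansive_maps_nonempty:
  assumes "\<And>x y. x \<in> X \<Longrightarrow> y \<in> X \<Longrightarrow> 0 \<le> d x y"
  shows "nonexpansive_maps X d \<noteq> {}"
proof -
  have "restrict (\<lambda>_. 0) X \<in> nonexpansive_maps X d"
    using assms by (auto simp: nonexpansive_maps_def)
  then show ?thesis by blast
qed

lemma expect_nonexpansive_diff_le_1:
  assumes "discrete_dist X \<pi>\<^sub>1" "discrete_dist X \<pi>\<^sub>2" "f \<in> nonexpansive_maps X d"
  shows "\<bar>expect X \<pi>\<^sub>1 f - expect X \<pi>\<^sub>2 f\<bar> \<le> 1"
  using expect_in_unit_interval[OF assms(1), of f] expect_in_unit_interval[OF assms(2), of f]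
    nonexpansive_mapsD(1)[OF assms(3)] by force

lemma kantorovich_discrete_dist:
  assumes "discrete_dist X \<pi>\<^sub>1" "discrete_dist X \<pi>\<^sub>2"
  shows "kantorovich X d \<pi>\<^sub>1 \<pi>\<^sub>2 = (SUP f\<in>nonexpansive_maps X d. \<bar>expect X \<pi>\<^sub>1 f - expect X \<pi>\<^sub>2 f\<bar>)"
  using discrete_dist_not_zero_on[OF assms(1)] discrete_dist_not_zero_on[OF assms(2)]
  by (simp add: kantorovich_def)

lemma wasserstein_discrete_dist:
  assumes "discrete_dist X \<pi>\<^sub>1" "discrete_dist X \<pi>\<^sub>2"
  shows "wasserstein X d \<pi>\<^sub>1 \<pi>\<^sub>2 = (INF \<mu>\<in>couplings X \<pi>\<^sub>1 \<pi>\<^sub>2. expect (X \<times> X) \<mu> (\<lambda>(x, y). d x y))"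
  using discrete_dist_not_zero_on[OF assms(1)] discrete_dist_not_zero_on[OF assms(2)]
  by (simp add: wasserstein_def)

lemma kantorovich_upper:
  assumes "discrete_dist X \<pi>\<^sub>1" "discrete_dist X \<pi>\<^sub>2" "f \<in> nonexpansive_maps X d"
  shows "\<bar>expect X \<pi>\<^sub>1 f - expect X \<pi>\<^sub>2 f\<bar> \<le> kantorovich X d \<pi>\<^sub>1 \<pi>\<^sub>2"
proof -
  have "bdd_above ((\<lambda>f. \<bar>expect X \<pi>\<^sub>1 f - expect X \<pi>\<^sub>2 f\<bar>) ` nonexpansive_maps X d)"
    using expect_nonexpansive_diff_le_1[OF assms(1,2)] by (intro bdd_aboveI2) blast
  then show ?thesis
    using assms(3) unfolding kantorovich_discrete_dist[OF assms(1,2)] by (intro cSUP_upper)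
qed

text \<open>Nonnegativity of \<open>d\<close> makes the zero map non-expansive, so the supremum is
  over a nonempty set.\<close>

lemma kantorovich_least:
  assumes "discrete_dist X \<pi>\<^sub>1" "discrete_dist X \<pi>\<^sub>2" "\<And>x y. x \<in> X \<Longrightarrow> y \<in> X \<Longrightarrow> 0 \<le> d x y"
    and "\<And>f. f \<in> nonexpansive_maps X d \<Longrightarrow> \<bar>expect X \<pi>\<^sub>1 f - expect X \<pi>\<^sub>2 f\<bar> \<le> K"
  shows "kantorovich X d \<pi>\<^sub>1 \<pi>\<^sub>2 \<le> K"
  unfolding kantorovich_discrete_dist[OF assms(1,2)]
  by (intro cSUP_least nonexpansive_maps_nonempty assms)

lemma wasserstein_lower:
  assumes "discrete_dist X \<pi>\<^sub>1" "discrete_dist X \<pi>\<^sub>2" "\<And>x y. x \<in> X \<Longrightarrow> y \<in> X \<Longrightarrow> 0 \<le> d x y"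
    and "\<mu> \<in> couplings X \<pi>\<^sub>1 \<pi>\<^sub>2"
  shows "wasserstein X d \<pi>\<^sub>1 \<pi>\<^sub>2 \<le> expect (X \<times> X) \<mu> (\<lambda>(x, y). d x y)"
proof -
  have "0 \<le> expect (X \<times> X) \<mu> (\<lambda>(x, y). d x y)" if "\<mu> \<in> couplings X \<pi>\<^sub>1 \<pi>\<^sub>2" for \<mu>
    using that assms(3) by (auto simp: expect_def couplings_def discrete_dist_def intro!: infsum_nonneg)
  then have "bdd_below ((\<lambda>\<mu>. expect (X \<times> X) \<mu> (\<lambda>(x, y). d x y)) ` couplings X \<pi>\<^sub>1 \<pi>\<^sub>2)"
    by (intro bdd_belowI2) blast
  then show ?thesis
    using assms(4) unfolding wasserstein_discrete_dist[OF assms(1,2)] by (intro cINF_lower)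
qed

lemma wasserstein_greatest:
  assumes "discrete_dist X \<pi>\<^sub>1" "discrete_dist X \<pi>\<^sub>2"
    and "\<And>\<mu>. \<mu> \<in> couplings X \<pi>\<^sub>1 \<pi>\<^sub>2 \<Longrightarrow> K \<le> expect (X \<times> X) \<mu> (\<lambda>(x, y). d x y)"
  shows "K \<le> wasserstein X d \<pi>\<^sub>1 \<pi>\<^sub>2"
  unfolding wasserstein_discrete_dist[OF assms(1,2)]
  by (intro cINF_greatest couplings_nonempty assms)

lemma kantorovich_le_wasserstein:
  assumes "discrete_dist X \<pi>\<^sub>1" "discrete_dist X \<pi>\<^sub>2" and d: "pseudometric_on X d"
    and d1: "\<And>x y. x \<in> X \<Longrightarrow> y \<in> X \<Longrightarrow> d x y \<le> 1"
  shows "kantorovich X d \<pi>\<^sub>1 \<pi>\<^sub>2 \<le> wasserstein X d \<pi>\<^sub>1 \<pi>\<^sub>2"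
proof (intro kantorovich_least wasserstein_greatest assms(1,2))
  have d0: "0 \<le> d x y" if "x \<in> X" "y \<in> X" for x y
    using d that by (auto simp: pseudometric_on_def)
  fix f \<mu> assume f: "f \<in> nonexpansive_maps X d" and \<mu>: "\<mu> \<in> couplings X \<pi>\<^sub>1 \<pi>\<^sub>2"
  \<comment> \<open>The one-sided estimates for \<open>f\<close> and for \<open>- f\<close> together
    bound the absolute value.\<close>
  have "expect X \<pi>\<^sub>1 f - expect X \<pi>\<^sub>2 f \<le> expect (X \<times> X) \<mu> (\<lambda>(x, y). d x y)"
    using nonexpansive_mapsD[OF f] d0 d1
    by (intro expect_diff_le_coupling[OF \<mu>, where B = 1 and C = 1]) (force simp: abs_le_iff)+
  moreover have "expect X \<pi>\<^sub>1 (\<lambda>x. - f x) - expect X \<pi>\<^sub>2 (\<lambda>x. - f x) \<le> expect (X \<times> X) \<mu> (\<lambda>(x, y). d x y)"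
    using nonexpansive_mapsD[OF f] d0 d1
    by (intro expect_diff_le_coupling[OF \<mu>, where B = 1 and C = 1]) (force simp: abs_le_iff)+
  moreover have "expect X \<pi> (\<lambda>x. - f x) = - expect X \<pi> f" for \<pi>
    by (simp add: expect_def infsum_uminus)
  ultimately show "\<bar>expect X \<pi>\<^sub>1 f - expect X \<pi>\<^sub>2 f\<bar> \<le> expect (X \<times> X) \<mu> (\<lambda>(x, y). d x y)"
    by simp
qed (use d in \<open>auto simp: pseudometric_on_def\<close>)

lemma totally_bounded_net:
  assumes "totally_bounded_pseudo X d" "0 < e"
  obtains F g where "finite F" "F \<subseteq> X" "\<And>x. x \<in> X \<Longrightarrow> g x \<in> F" "\<And>x. x \<in> X \<Longrightarrow> d (g x) x \<le> e"
proof -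
  from assms obtain F where F: "finite F" "F \<subseteq> X" "X \<subseteq> (\<Union>x\<in>F. {y\<in>X. d x y \<le> e})"
    unfolding totally_bounded_pseudo_def by meson
  have "\<exists>u. u \<in> F \<and> d u x \<le> e" if "x \<in> X" for x
    using subsetD[OF F(3) that] by blast
  then obtain g where "\<And>x. x \<in> X \<Longrightarrow> g x \<in> F \<and> d (g x) x \<le> e"
    by metis
  then show thesis using that F by blast
qed

text \<open>Collapse \<open>X\<close> onto a finite net by \<open>g\<close>, solve the transport
  problem between the push-forwards, and lift the optimal coupling back. Points move by at most
  \<open>e\<close>, which perturbs the expectations of the potential and the transport cost only
  slightly.\<close>

lemma wasserstein_le_kantorovich:
  assumes \<pi>: "discrete_dist X \<pi>\<^sub>1" "discrete_dist X \<pi>\<^sub>2" and d: "pseudometric_on X d"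
    and d1: "\<And>x y. x \<in> X \<Longrightarrow> y \<in> X \<Longrightarrow> d x y \<le> 1" and tb: "totally_bounded_pseudo X d"
  shows "wasserstein X d \<pi>\<^sub>1 \<pi>\<^sub>2 \<le> kantorovich X d \<pi>\<^sub>1 \<pi>\<^sub>2"
proof (rule field_le_epsilon)
  fix e' :: real assume "0 < e'"
  \<comment> \<open>The total error is four times \<open>e\<close>: one for each of the two
    expectations of the potential, and one for each coordinate of the coupling.\<close>
  define e where "e = e' / 4"
  have "0 < e" using \<open>0 < e'\<close> by (simp add: e_def)
  have d0: "0 \<le> d x y" if "x \<in> X" "y \<in> X" for x y
    using d that by (auto simp: pseudometric_on_def)
  obtain F g where F: "finite F" "F \<subseteq> X"
    and g: "\<And>x. x \<in> X \<Longrightarrow> g x \<in> F" "\<And>x. x \<in> X \<Longrightarrow> d (g x) x \<le> e"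
    using totally_bounded_net[OF tb \<open>0 < e\<close>] by blast
  have gX: "g x \<in> X" if "x \<in> X" for x using g F that by auto
  have gF: "g ` X \<subseteq> F" using g by auto
  define P where "P u = (\<Sum>\<^sub>\<infinity>x\<in>{x\<in>X. g x = u}. \<pi>\<^sub>1 x)" for u
  define Q where "Q u = (\<Sum>\<^sub>\<infinity>x\<in>{x\<in>X. g x = u}. \<pi>\<^sub>2 x)" for u
  have push: "expect X \<pi> (\<lambda>x. h (g x)) = (\<Sum>u\<in>F. (\<Sum>\<^sub>\<infinity>x\<in>{x\<in>X. g x = u}. \<pi> x) * h u)"
    if "discrete_dist X \<pi>" for \<pi> h
    unfolding expect_def using that
    by (intro infsumI has_sum_fibres[OF F(1) gF]) (auto simp: discrete_dist_def summable_on_def)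
  have sums: "sum P F = 1" "sum Q F = 1"
    using push[OF \<pi>(1), of "\<lambda>_. 1"] push[OF \<pi>(2), of "\<lambda>_. 1"]
    by (simp_all add: P_def Q_def expect_const[OF \<pi>(1)] expect_const[OF \<pi>(2)])
  have PQ: "0 \<le> P u" "0 \<le> Q u" for u
    unfolding P_def Q_def by (intro fibre_mass_nonneg \<pi>)+
  obtain \<nu> f where \<nu>: "fin_coupling F P Q \<nu>"
    and lip: "\<And>x y. x \<in> X \<Longrightarrow> y \<in> X \<Longrightarrow> \<bar>f x - f y\<bar> \<le> d x y"
    and cost: "cost F d \<nu> = (\<Sum>x\<in>F. P x * f x) - (\<Sum>x\<in>F. Q x * f x)"
    using that by (rule finite_duality[OF d F PQ(1) sums(1) PQ(2) sums(2)])
  have "bdd_below (f ` X)"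
  proof (cases "X = {}")
    case False
    then obtain x0 where "x0 \<in> X" by auto
    then show ?thesis using lip[of x0] d1[of x0] by (intro bdd_belowI2[of _ "f x0 - 1"]) force
  qed auto
  \<comment> \<open>The potential oscillates by at most 1 because \<open>d\<close> is bounded by 1,
    so subtracting its infimum puts it into the unit interval. The constant cancels from the
    difference of expectations since both push-forwards have total mass 1.\<close>
  define f' where "f' = restrict (\<lambda>x. f x - Inf (f ` X)) X"
  have f': "f' \<in> nonexpansive_maps X d"
  proof -
    have "Inf (f ` X) \<le> f x" if "x \<in> X" for x
      using \<open>bdd_below (f ` X)\<close> that by (auto intro: cINF_lower)
    moreover have "f x - Inf (f ` X) \<le> 1" if "x \<in> X" for x
    proof -
      have "f x - 1 \<le> Inf (f ` X)"
        using that lip[of x] d1[of x] by (intro cINF_greatest) force+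
      then show ?thesis by simp
    qed
    ultimately show ?thesis
      using lip by (auto simp: nonexpansive_maps_def f'_def)
  qed
  have cost': "cost F d \<nu> = (\<Sum>x\<in>F. P x * f' x) - (\<Sum>x\<in>F. Q x * f' x)"
  proof -
    have "(\<Sum>x\<in>F. R x * f' x) = (\<Sum>x\<in>F. R x * f x) - Inf (f ` X)" if "sum R F = 1" for R
    proof -
      have "(\<Sum>x\<in>F. R x * f' x) = (\<Sum>x\<in>F. R x * f x - R x * Inf (f ` X))"
        using F(2) by (intro sum.cong) (auto simp: f'_def algebra_simps)
      then show ?thesis using that by (simp add: sum_subtractf flip: sum_distrib_right)
    qed
    then show ?thesis using cost sums by simp
  qed
  have near: "\<bar>expect X \<pi> f' - expect X \<pi> (\<lambda>x. f' (g x))\<bar> \<le> e" if "discrete_dist X \<pi>" for \<pi>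
  proof (rule expect_diff_le[OF that, where B = 1 and C = 1])
    fix x assume "x \<in> X"
    show "\<bar>f' x\<bar> \<le> 1" "\<bar>f' (g x)\<bar> \<le> 1"
      using nonexpansive_mapsD(3)[OF f'] \<open>x \<in> X\<close> gX by auto
    show "\<bar>f' x - f' (g x)\<bar> \<le> e"
      using nonexpansive_mapsD(2)[OF f' gX[OF \<open>x \<in> X\<close>] \<open>x \<in> X\<close>] g(2)[OF \<open>x \<in> X\<close>] by linarith
  qed
  have "cost F d \<nu> \<le> kantorovich X d \<pi>\<^sub>1 \<pi>\<^sub>2 + 2 * e"
    using near[OF \<pi>(1)] near[OF \<pi>(2)] kantorovich_upper[OF \<pi> f'] cost'
    unfolding push[OF \<pi>(1)] push[OF \<pi>(2)] P_def Q_def by linarith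
  obtain \<mu> where \<mu>: "\<mu> \<in> couplings X \<pi>\<^sub>1 \<pi>\<^sub>2"
    and exp: "expect (X \<times> X) \<mu> (\<lambda>(x, y). d (g x) (g y)) = cost F d \<nu>"
  proof (rule lift_fin_coupling[OF \<pi> F(1) gF P_def Q_def \<nu>])
    fix \<mu> assume "\<mu> \<in> couplings X \<pi>\<^sub>1 \<pi>\<^sub>2"
      and *: "\<And>k. (\<And>u v. u \<in> F \<Longrightarrow> v \<in> F \<Longrightarrow> 0 \<le> k u v) \<Longrightarrow>
           expect (X \<times> X) \<mu> (\<lambda>(x, y). k (g x) (g y)) = cost F k \<nu>"
    moreover have "expect (X \<times> X) \<mu> (\<lambda>(x, y). d (g x) (g y)) = cost F d \<nu>"
      using d0 F(2) by (intro *) blast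
    ultimately show thesis using that by blast
  qed
  have dd: "discrete_dist (X \<times> X) \<mu>" using \<mu> by (simp add: couplings_def)
  have "\<bar>expect (X \<times> X) \<mu> (\<lambda>(x, y). d x y) - expect (X \<times> X) \<mu> (\<lambda>(x, y). d (g x) (g y))\<bar> \<le> 2 * e"
  proof (rule expect_diff_le[OF dd, where B = 1 and C = 1])
    fix z assume "z \<in> X \<times> X"
    then obtain x y where z: "z = (x, y)" and xy: "x \<in> X" "y \<in> X" by auto
    have tri: "d a c \<le> d a b + d b c" "d a b = d b a" if "a \<in> X" "b \<in> X" "c \<in> X" for a b c
      using d that unfolding pseudometric_on_def by blast+
    show "\<bar>case z of (x, y) \<Rightarrow> d x y\<bar> \<le> 1" "\<bar>case z of (x, y) \<Rightarrow> d (g x) (g y)\<bar> \<le> 1"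
      using xy z d0 d1 gX by auto
    have "d x y \<le> d (g x) (g y) + 2 * e" "d (g x) (g y) \<le> d x y + 2 * e"
      using tri(1)[of x "g x" y] tri(1)[of "g x" "g y" y] tri(1)[of "g x" x "g y"] tri(1)[of x y "g y"]
        tri(2)[of x "g x" x] tri(2)[of y "g y" y] g(2)[OF xy(1)] g(2)[OF xy(2)] xy gX[OF xy(1)] gX[OF xy(2)]
      by linarith+
    then show "\<bar>(case z of (x, y) \<Rightarrow> d x y) - (case z of (x, y) \<Rightarrow> d (g x) (g y))\<bar> \<le> 2 * e"
      using z by auto
  qed
  moreover have "wasserstein X d \<pi>\<^sub>1 \<pi>\<^sub>2 \<le> expect (X \<times> X) \<mu> (\<lambda>(x, y). d x y)"
    using d0 by (intro wasserstein_lower[OF \<pi> _ \<mu>])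
  ultimately have "wasserstein X d \<pi>\<^sub>1 \<pi>\<^sub>2 \<le> cost F d \<nu> + 2 * e"
    using exp by linarith
  then show "wasserstein X d \<pi>\<^sub>1 \<pi>\<^sub>2 \<le> kantorovich X d \<pi>\<^sub>1 \<pi>\<^sub>2 + e'"
    using \<open>cost F d \<nu> \<le> _\<close> by (simp add: e_def)
qed

lemma kantorovich_wasserstein_duality:
  assumes "zero_on X \<pi>\<^sub>1 \<or> discrete_dist X \<pi>\<^sub>1" "zero_on X \<pi>\<^sub>2 \<or> discrete_dist X \<pi>\<^sub>2"
    and "pseudometric_on X d" "\<And>x y. x \<in> X \<Longrightarrow> y \<in> X \<Longrightarrow> d x y \<le> 1" "totally_bounded_pseudo X d"
  shows "wasserstein X d \<pi>\<^sub>1 \<pi>\<^sub>2 = kantorovich X d \<pi>\<^sub>1 \<pi>\<^sub>2"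
proof (cases "zero_on X \<pi>\<^sub>1 \<or> zero_on X \<pi>\<^sub>2")
  case True
  then show ?thesis by (auto simp: wasserstein_def kantorovich_def)
next
  case False
  then show ?thesis
    using assms kantorovich_le_wasserstein[of X \<pi>\<^sub>1 \<pi>\<^sub>2 d] wasserstein_le_kantorovich[of X \<pi>\<^sub>1 \<pi>\<^sub>2 d]
    by (auto intro: order_antisym)
qed

section \<open>Total boundedness and finite nets\<close>

lemma floor_div_eq_close:
  fixes x y e :: real
  assumes "0 < e" "\<lfloor>x / e\<rfloor> = \<lfloor>y / e\<rfloor>"
  shows "\<bar>x - y\<bar> \<le> e"
proof -
  have "\<bar>x / e - y / e\<bar> \<le> 1"
    using assms(2) by linarith
  then have "\<bar>(x - y) / e\<bar> \<le> 1" by (simp add: diff_divide_distrib)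
  then show ?thesis using assms(1) by (simp add: field_simps)
qed

lemma floor_div_unit_interval:
  fixes x e :: real
  assumes "0 < e" "x \<in> {0..1}"
  shows "\<lfloor>x / e\<rfloor> \<in> {0..\<lfloor>1 / e\<rfloor>}"
  using assms by (auto intro!: floor_mono divide_right_mono)

text \<open>One representative per class of a finite classification forms the net. In this form
  total boundedness reduces to recording finitely many rounded data about a point.\<close>

lemma totally_bounded_pseudoI:
  assumes "\<And>e. 0 < e \<Longrightarrow> \<exists>\<Phi> :: 'a \<Rightarrow> 'b. finite (\<Phi> ` X) \<and> (\<forall>x\<in>X. \<forall>y\<in>X. \<Phi> x = \<Phi> y \<longrightarrow> d x y \<le> e)"
  shows "totally_bounded_pseudo X d"
  unfolding totally_bounded_pseudo_def
proof (intro allI impI)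
  fix e :: real assume "0 < e"
  from assms[OF this] obtain \<Phi> :: "'a \<Rightarrow> 'b" where fin: "finite (\<Phi> ` X)"
    and close: "\<And>x y. x \<in> X \<Longrightarrow> y \<in> X \<Longrightarrow> \<Phi> x = \<Phi> y \<Longrightarrow> d x y \<le> e" by blast
  show "\<exists>F. finite F \<and> F \<subseteq> X \<and> X \<subseteq> (\<Union>x\<in>F. {y\<in>X. d x y \<le> e})"
  proof (intro exI[of _ "inv_into X \<Phi> ` \<Phi> ` X"] conjI)
    show "finite (inv_into X \<Phi> ` \<Phi> ` X)" using fin by simp
    show "inv_into X \<Phi> ` \<Phi> ` X \<subseteq> X" by (auto intro: inv_into_into)
    show "X \<subseteq> (\<Union>x\<in>inv_into X \<Phi> ` \<Phi> ` X. {y\<in>X. d x y \<le> e})"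
    proof
      fix y assume "y \<in> X"
      then have "d (inv_into X \<Phi> (\<Phi> y)) y \<le> e"
        by (intro close) (auto intro: inv_into_into f_inv_into_f)
      then show "y \<in> (\<Union>x\<in>inv_into X \<Phi> ` \<Phi> ` X. {y\<in>X. d x y \<le> e})"
        using \<open>y \<in> X\<close> by blast
    qed
  qed
qed

text \<open>The Arzela-Ascoli argument: a non-expansive map is determined up to \<open>e\<close> by
  its rounded values on a finite net. Rounding costs \<open>e / 3\<close>, and passing between
  \<open>x\<close> and its net point costs \<open>e / 3\<close> for each of the two maps.\<close>

lemma nonexpansive_maps_finite_net:
  fixes d :: "'a \<Rightarrow> 'a \<Rightarrow> real"
  assumes tb: "totally_bounded_pseudo X d" and "0 < e"
  obtains N where "finite N" "N \<subseteq> nonexpansive_maps X d"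
    "\<And>f. f \<in> nonexpansive_maps X d \<Longrightarrow> \<exists>h\<in>N. \<forall>x\<in>X. \<bar>f x - h x\<bar> \<le> e"
proof -
  let ?M = "nonexpansive_maps X d"
  have "0 < e / 3" using \<open>0 < e\<close> by simp
  obtain F g where F: "finite F" "F \<subseteq> X"
    and g: "\<And>x. x \<in> X \<Longrightarrow> g x \<in> F" "\<And>x. x \<in> X \<Longrightarrow> d (g x) x \<le> e / 3"
    using totally_bounded_net[OF tb \<open>0 < e / 3\<close>] by blast
  define \<Phi> :: "('a \<Rightarrow> real) \<Rightarrow> 'a \<Rightarrow> int" where "\<Phi> f = restrict (\<lambda>u. \<lfloor>f u / (e / 3)\<rfloor>) F" for f
  have "\<Phi> ` ?M \<subseteq> F \<rightarrow>\<^sub>E {0..\<lfloor>1 / (e / 3)\<rfloor>}"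
  proof (rule image_subsetI)
    fix f assume "f \<in> ?M"
    show "\<Phi> f \<in> F \<rightarrow>\<^sub>E {0..\<lfloor>1 / (e / 3)\<rfloor>}"
      unfolding \<Phi>_def restrict_PiE_iff
      by (intro ballI floor_div_unit_interval[OF \<open>0 < e / 3\<close>]
          nonexpansive_mapsD(1)[OF \<open>f \<in> ?M\<close>] subsetD[OF F(2)])
  qed
  then have fin: "finite (\<Phi> ` ?M)"
    by (rule finite_subset) (simp add: F(1) finite_PiE)
  show thesis
  proof
    show "finite (inv_into ?M \<Phi> ` \<Phi> ` ?M)" using fin by simp
    show "inv_into ?M \<Phi> ` \<Phi> ` ?M \<subseteq> ?M" by (auto intro: inv_into_into)
    fix f assume f: "f \<in> ?M"
    define h where "h = inv_into ?M \<Phi> (\<Phi> f)"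
    have h: "h \<in> ?M" "\<Phi> h = \<Phi> f"
      unfolding h_def using f by (simp_all add: inv_into_into f_inv_into_f)
    have "\<bar>f x - h x\<bar> \<le> e" if x: "x \<in> X" for x
    proof -
      have "\<lfloor>f (g x) / (e / 3)\<rfloor> = \<lfloor>h (g x) / (e / 3)\<rfloor>"
        using fun_cong[OF h(2), of "g x"] g(1)[OF x] by (simp add: \<Phi>_def)
      then have "\<bar>f (g x) - h (g x)\<bar> \<le> e / 3"
        by (rule floor_div_eq_close[OF \<open>0 < e / 3\<close>])
      moreover have "\<bar>f (g x) - f x\<bar> \<le> d (g x) x" "\<bar>h (g x) - h x\<bar> \<le> d (g x) x"
        using nonexpansive_mapsD(2)[OF f] nonexpansive_mapsD(2)[OF h(1)] g(1)[OF x] F(2) x by blast+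
      ultimately show ?thesis using g(2)[OF x] by linarith
    qed
    then show "\<exists>h\<in>inv_into ?M \<Phi> ` \<Phi> ` ?M. \<forall>x\<in>X. \<bar>f x - h x\<bar> \<le> e"
      using f unfolding h_def by blast
  qed
qed

text \<open>The distances will be shown equal only on the states, not as functions, so the
  constructions built from them need congruence rules relative to \<open>X\<close>.\<close>

lemma nonexpansive_maps_cong:
  assumes "\<And>x y. x \<in> X \<Longrightarrow> y \<in> X \<Longrightarrow> d x y = d' x y"
  shows "nonexpansive_maps X d = nonexpansive_maps X d'"
  using assms by (auto simp: nonexpansive_maps_def)

lemma kantorovich_cong:
  assumes "\<And>x y. x \<in> X \<Longrightarrow> y \<in> X \<Longrightarrow> d x y = d' x y"
  shows "kantorovich X d \<pi>\<^sub>1 \<pi>\<^sub>2 = kantorovich X d' \<pi>\<^sub>1 \<pi>\<^sub>2"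
  unfolding kantorovich_def using nonexpansive_maps_cong[of X d d'] assms by simp

lemma wasserstein_cong:
  assumes "\<And>x y. x \<in> X \<Longrightarrow> y \<in> X \<Longrightarrow> d x y = d' x y"
  shows "wasserstein X d \<pi>\<^sub>1 \<pi>\<^sub>2 = wasserstein X d' \<pi>\<^sub>1 \<pi>\<^sub>2"
proof -
  have "expect (X \<times> X) \<mu> (\<lambda>(x, y). d x y) = expect (X \<times> X) \<mu> (\<lambda>(x, y). d' x y)" for \<mu>
    using assms by (intro expect_cong) auto
  then show ?thesis by (simp add: wasserstein_def)
qed

lemma totally_bounded_pseudo_cong:
  assumes "\<And>x y. x \<in> X \<Longrightarrow> y \<in> X \<Longrightarrow> d x y = d' x y"
  shows "totally_bounded_pseudo X d = totally_bounded_pseudo X d'"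
proof -
  have "(\<Union>x\<in>F. {y\<in>X. d x y \<le> e}) = (\<Union>x\<in>F. {y\<in>X. d' x y \<le> e})" if "F \<subseteq> X" for F e
    using assms that by (intro SUP_cong refl Collect_cong conj_cong) auto
  then show ?thesis unfolding totally_bounded_pseudo_def by (simp cong: conj_cong)
qed

lemma rat_approx_unit_interval:
  fixes r e :: real
  assumes "r \<in> {0..1}" "0 < e"
  obtains q :: rat where "0 \<le> q" "q \<le> 1" "\<bar>of_rat q - r\<bar> \<le> e"
proof -
  have "max 0 (r - e) < min 1 (r + e)" using assms by auto
  then obtain q where "max 0 (r - e) < of_rat q" "of_rat q < min 1 (r + e)"
    using of_rat_dense by blast
  then show thesis using that[of q] by auto
qed

section \<open>Concepts and the logical distance\<close>

locale finite_alc_model =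
  fixes NC :: "'c set" and I :: "('s, 'c) model"
  assumes finite_NC: "finite NC" and model: "is_model NC I"
begin

section \<open>Blocking states, expectations and atomic distances\<close>

abbreviation X where "X \<equiv> states I"

lemma conc_unit_interval: "A \<in> NC \<Longrightarrow> a \<in> X \<Longrightarrow> conc I A a \<in> {0..1}"
  using model unfolding is_model_def by blast

lemma role_nonneg: "a \<in> X \<Longrightarrow> b \<in> X \<Longrightarrow> 0 \<le> role I a b"
  using model unfolding is_model_def by fastforce

lemma blocking_iff_zero_on:
  assumes "a \<in> X"
  shows "blocking I a \<longleftrightarrow> zero_on X (role I a)"
proof
  assume "blocking I a"
  then show "zero_on X (role I a)"
    using nonneg_has_sum_le_0D[where f = "role I a" and a = 0 and A = X] role_nonneg[OF assms]
    by (auto simp: blocking_def zero_on_def)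
qed (auto simp: blocking_def zero_on_def intro: has_sum_0)

lemma nonblocking_discrete_dist:
  assumes "a \<in> X" "\<not> blocking I a"
  shows "discrete_dist X (role I a)"
  using assms model role_nonneg by (auto simp: is_model_def blocking_def discrete_dist_def)

lemma zero_on_or_discrete_dist:
  "a \<in> X \<Longrightarrow> zero_on X (role I a) \<or> discrete_dist X (role I a)"
  using blocking_iff_zero_on nonblocking_discrete_dist by blast

lemma expect_blocking:
  assumes "a \<in> X" "blocking I a"
  shows "expect X (role I a) f = 0"
  using assms blocking_iff_zero_on by (auto simp: expect_def zero_on_def intro: infsum_0)

lemma expect_role_unit_interval:
  assumes "a \<in> X" "\<And>x. x \<in> X \<Longrightarrow> f x \<in> {0..1}"
  shows "expect X (role I a) f \<in> {0..1}"
proof (cases "blocking I a")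
  case True
  then show ?thesis using expect_blocking[OF assms(1)] by simp
next
  case False
  then show ?thesis
    using assms by (intro expect_in_unit_interval nonblocking_discrete_dist)
qed

lemma kantorovich_blocking:
  assumes "a \<in> X" "b \<in> X" "blocking I a \<or> blocking I b"
  shows "kantorovich X d (role I a) (role I b) = of_bool (blocking I a \<noteq> blocking I b)"
  using assms blocking_iff_zero_on by (auto simp: kantorovich_def)

lemma wasserstein_blocking:
  assumes "a \<in> X" "b \<in> X" "blocking I a \<or> blocking I b"
  shows "wasserstein X d (role I a) (role I b) = of_bool (blocking I a \<noteq> blocking I b)"
  using assms blocking_iff_zero_on by (auto simp: wasserstein_def)

lemma atom_dist_upper: "A \<in> NC \<Longrightarrow> \<bar>conc I A a - conc I A b\<bar> \<le> atom_dist NC I a b"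
  unfolding atom_dist_def using finite_NC by (intro Max_ge) auto

lemma atom_dist_nonneg: "0 \<le> atom_dist NC I a b"
  unfolding atom_dist_def using finite_NC by (intro Max_ge) auto

lemma atom_dist_le_iff:
  "atom_dist NC I a b \<le> t \<longleftrightarrow> 0 \<le> t \<and> (\<forall>A\<in>NC. \<bar>conc I A a - conc I A b\<bar> \<le> t)"
  unfolding atom_dist_def using finite_NC by (subst Max_le_iff) auto

lemma interp_unit_interval:
  "concept_over NC C \<Longrightarrow> a \<in> X \<Longrightarrow> interp I C a \<in> {0..1}"
proof (induction C arbitrary: a)
  case (Atom A)
  then show ?case using conc_unit_interval by simp
next
  case (Minus C q)
  then have "interp I C a \<in> {0..1}" by simp
  moreover have "(0::real) \<le> of_rat q" using Minus by simp
  ultimately have "max (interp I C a - of_rat q) 0 \<in> {0..1}" by (simp del: zero_le_of_rat_iff)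
  then show ?case by simp
next
  case (Diamond C)
  then show ?case
    using expect_role_unit_interval[of a "interp I C"] by simp
qed (fastforce simp: min_def)+

section \<open>Concepts of bounded rank and their distance\<close>

definition concepts :: "nat \<Rightarrow> 'c concept set" where
  "concepts n = {C. concept_over NC C \<and> rk C \<le> n}"

lemma conceptsD: "C \<in> concepts n \<Longrightarrow> concept_over NC C"
  by (simp add: concepts_def)

lemma concepts_closed [simp]:
  "Rational q \<in> concepts n \<longleftrightarrow> 0 \<le> q \<and> q \<le> 1"
  "Minus C q \<in> concepts n \<longleftrightarrow> C \<in> concepts n \<and> 0 \<le> q \<and> q \<le> 1"
  "Neg C \<in> concepts n \<longleftrightarrow> C \<in> concepts n"
  "Conj C D \<in> concepts n \<longleftrightarrow> C \<in> concepts n \<and> D \<in> concepts n"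
  "Atom A \<in> concepts (Suc n) \<longleftrightarrow> A \<in> NC"
  "Diamond C \<in> concepts (Suc n) \<longleftrightarrow> C \<in> concepts n"
  by (auto simp: concepts_def)

lemma interp_diff_le_1:
  assumes "C \<in> concepts n" "a \<in> X" "b \<in> X"
  shows "\<bar>interp I C a - interp I C b\<bar> \<le> 1"
  using interp_unit_interval[OF conceptsD[OF assms(1)] assms(2)]
    interp_unit_interval[OF conceptsD[OF assms(1)] assms(3)] by auto

lemma dL_bdd_above:
  assumes "a \<in> X" "b \<in> X"
  shows "bdd_above ((\<lambda>C. \<bar>interp I C a - interp I C b\<bar>) ` concepts n)"
  using interp_diff_le_1 assms by (intro bdd_aboveI2) blast

lemma dL_eq: "dL NC I n a b = (SUP C\<in>concepts n. \<bar>interp I C a - interp I C b\<bar>)"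
  by (simp add: dL_def concepts_def)

lemma concepts_nonempty: "concepts n \<noteq> {}"
  using concepts_closed(1)[of 0 n] by fastforce

lemma dL_upper:
  assumes "C \<in> concepts n" "a \<in> X" "b \<in> X"
  shows "\<bar>interp I C a - interp I C b\<bar> \<le> dL NC I n a b"
  unfolding dL_eq using assms dL_bdd_above by (intro cSUP_upper)

lemma dL_least:
  assumes "\<And>C. C \<in> concepts n \<Longrightarrow> \<bar>interp I C a - interp I C b\<bar> \<le> K"
  shows "dL NC I n a b \<le> K"
  unfolding dL_eq using assms concepts_nonempty by (intro cSUP_least)

lemma dL_le_1: "a \<in> X \<Longrightarrow> b \<in> X \<Longrightarrow> dL NC I n a b \<le> 1"
  using interp_diff_le_1 by (intro dL_least)

lemma dL_nonneg: "a \<in> X \<Longrightarrow> b \<in> X \<Longrightarrow> 0 \<le> dL NC I n a b"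
  using dL_upper[of "Rational 0" n a b] by simp

lemma dL_pseudometric: "pseudometric_on X (dL NC I n)"
  unfolding pseudometric_on_def
proof (intro conjI ballI)
  fix a b c assume X: "a \<in> X" "b \<in> X" "c \<in> X"
  show "dL NC I n a c \<le> dL NC I n a b + dL NC I n b c"
  proof (rule dL_least)
    fix C assume "C \<in> concepts n"
    then show "\<bar>interp I C a - interp I C c\<bar> \<le> dL NC I n a b + dL NC I n b c"
      using dL_upper[of C n a b] dL_upper[of C n b c] X by linarith
  qed
qed (use dL_nonneg in \<open>auto simp: dL_eq abs_minus_commute concepts_nonempty\<close>)

text \<open>Negation reverses the sign of a difference of values, so the supremum can be approached
  without absolute values.\<close>

lemma dL_approx:
  assumes "a \<in> X" "b \<in> X" "0 < e"
  obtains C where "C \<in> concepts n" "dL NC I n a b - e < interp I C a - interp I C b"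
proof -
  have "dL NC I n a b - e < dL NC I n a b" using assms by simp
  then obtain C where C: "C \<in> concepts n" "dL NC I n a b - e < \<bar>interp I C a - interp I C b\<bar>"
    unfolding dL_eq less_cSUP_iff[OF concepts_nonempty dL_bdd_above[OF assms(1,2)]] by blast
  then show thesis
    using that[of C] that[of "Neg C"] by (cases "interp I C b \<le> interp I C a") auto
qed

text \<open>A concept that nearly attains \<open>dL\<close> at \<open>a\<close> and \<open>b\<close>
  separates them by almost \<open>u - v\<close> or more; it is shifted down, truncated and shifted
  up to take roughly the values \<open>u\<close> and \<open>v\<close>.\<close>

lemma two_point_approx_ge:
  assumes X: "a \<in> X" "b \<in> X" and e: "0 < e" and uv: "u \<in> {0..1}" "v \<in> {0..1}" "v \<le> u" "u - v \<le> dL NC I n a b"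
  obtains C where "C \<in> concepts n" "\<bar>interp I C a - u\<bar> \<le> 3 * e" "\<bar>interp I C b - v\<bar> \<le> 3 * e"
proof -
  obtain D where D: "D \<in> concepts n" "dL NC I n a b - e < interp I D a - interp I D b"
    using dL_approx[OF X e] by blast
  have "interp I D b \<in> {0..1}"
    using interp_unit_interval conceptsD[OF D(1)] X by blast
  then obtain q1 where q1: "0 \<le> q1" "q1 \<le> 1" "\<bar>of_rat q1 - interp I D b\<bar> \<le> e"
    using rat_approx_unit_interval e by blast
  have "u - v \<in> {0..1}" using uv by auto
  then obtain q2 where q2: "0 \<le> q2" "q2 \<le> 1" "\<bar>of_rat q2 - (u - v)\<bar> \<le> e"
    using rat_approx_unit_interval e by blast
  obtain q3 where q3: "0 \<le> q3" "q3 \<le> 1" "\<bar>of_rat q3 - v\<bar> \<le> e"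
    using rat_approx_unit_interval[OF uv(2) e] by blast
  \<comment> \<open>Subtracting \<open>q1\<close>, about the value of \<open>D\<close> at
    \<open>b\<close>, sends the value at \<open>b\<close> to about 0; the conjunction caps the value
    at \<open>a\<close> at about \<open>u - v\<close>. Subtracting \<open>q3\<close> under a double
    negation is addition truncated at 1, which supplies the offset \<open>v\<close>.\<close>
  let ?C = "Neg (Minus (Neg (Conj (Minus D q1) (Rational q2))) q3)"
  have arith: "\<bar>1 - max (1 - min (max (x - r1) 0) r2 - r3) 0 - u\<bar> \<le> 3 * e"
      "\<bar>1 - max (1 - min (max (y - r1) 0) r2 - r3) 0 - v\<bar> \<le> 3 * e"
    if "0 \<le> r2" "\<bar>r1 - y\<bar> \<le> e" "\<bar>r2 - (u - v)\<bar> \<le> e" "\<bar>r3 - v\<bar> \<le> e" "u - v - e < x - y"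
    for x y r1 r2 r3 :: real
    using that uv(1-3) e by (auto simp: abs_le_iff min_def max_def)
  have "0 \<le> real_of_rat q2" "u - v - e < interp I D a - interp I D b"
    using q2(1) D(2) uv(4) by auto
  then have "\<bar>interp I ?C a - u\<bar> \<le> 3 * e" "\<bar>interp I ?C b - v\<bar> \<le> 3 * e"
    unfolding interp.simps using arith q1(3) q2(3) q3(3) by blast+
  moreover have "?C \<in> concepts n" using D(1) q1 q2 q3 by simp
  ultimately show thesis using that by blast
qed

lemma two_point_approx:
  assumes X: "a \<in> X" "b \<in> X" and e: "0 < e" and uv: "u \<in> {0..1}" "v \<in> {0..1}" "\<bar>u - v\<bar> \<le> dL NC I n a b"
  obtains C where "C \<in> concepts n" "\<bar>interp I C a - u\<bar> \<le> 3 * e" "\<bar>interp I C b - v\<bar> \<le> 3 * e"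
proof (cases "v \<le> u")
  case True
  then have "u - v \<le> dL NC I n a b" using uv(3) by simp
  from two_point_approx_ge[OF X e uv(1,2) True this] show thesis using that by blast
next
  case False
  then have "v - u \<le> dL NC I n b a" "u \<le> v"
    using uv(3) dL_pseudometric X by (auto simp: pseudometric_on_def)
  from two_point_approx_ge[OF X(2,1) e uv(2,1) this(2,1)] show thesis using that by blast
qed

lemma finite_Min_concept:
  assumes "finite G" "G \<noteq> {}" "\<And>g. g \<in> G \<Longrightarrow> h g \<in> concepts n"
  shows "\<exists>C\<in>concepts n. \<forall>x. interp I C x = (MIN g\<in>G. interp I (h g) x)"
  using assms
proof (induction rule: finite_ne_induct)
  case (singleton g)
  then show ?case by (intro bexI[of _ "h g"]) auto
next
  case (insert g G)
  then obtain C where "C \<in> concepts n" "\<forall>x. interp I C x = (MIN g\<in>G. interp I (h g) x)" by auto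
  then show ?case using insert by (intro bexI[of _ "Conj (h g) C"]) auto
qed

lemma finite_Max_concept:
  assumes "finite G" "G \<noteq> {}" "\<And>g. g \<in> G \<Longrightarrow> h g \<in> concepts n"
  shows "\<exists>C\<in>concepts n. \<forall>x. interp I C x = (MAX g\<in>G. interp I (h g) x)"
  using assms
proof (induction rule: finite_ne_induct)
  case (singleton g)
  then show ?case by (intro bexI[of _ "h g"]) auto
next
  case (insert g G)
  then obtain C where "C \<in> concepts n" "\<forall>x. interp I C x = (MAX g\<in>G. interp I (h g) x)" by auto
  moreover have "1 - min (1 - s) (1 - t) = max s t" for s t :: real by (simp add: min_def max_def)
  ultimately show ?case using insert by (intro bexI[of _ "Neg (Conj (Neg (h g)) (Neg C))"]) auto
qed

text \<open>For a net point \<open>a\<close>, take the minimum over \<open>b\<close> of concepts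
  matching \<open>f\<close> at \<open>a\<close> and \<open>b\<close>: it matches \<open>f\<close> at
  \<open>a\<close> and is at most slightly above \<open>f\<close> on the whole net. The maximum over
  \<open>a\<close> is then close to \<open>f\<close> on the net, and non-expansiveness of both sides
  carries this to \<open>X\<close>.\<close>

lemma concepts_dense:
  assumes tb: "totally_bounded_pseudo X (dL NC I n)" and f: "f \<in> nonexpansive_maps X (dL NC I n)" and "0 < e"
  shows "\<exists>C\<in>concepts n. \<forall>x\<in>X. \<bar>interp I C x - f x\<bar> \<le> e"
proof (cases "X = {}")
  case True
  then show ?thesis using concepts_nonempty by auto
next
  case False
  \<comment> \<open>Three parts come from the interpolation on the net, one each from moving the
    concept and \<open>f\<close> off the net.\<close>
  define e' where "e' = e / 5"
  have e': "0 < e'" using \<open>0 < e\<close> by (simp add: e'_def)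
  obtain F g where F: "finite F" "F \<subseteq> X"
    and g: "\<And>x. x \<in> X \<Longrightarrow> g x \<in> F" "\<And>x. x \<in> X \<Longrightarrow> dL NC I n (g x) x \<le> e'"
    using totally_bounded_net[OF tb e'] by blast
  have "F \<noteq> {}" using False g by blast
  have "\<exists>C. C \<in> concepts n \<and> \<bar>interp I C a - f a\<bar> \<le> 3 * e' \<and> \<bar>interp I C b - f b\<bar> \<le> 3 * e'"
    if "a \<in> F" "b \<in> F" for a b
  proof -
    have ab: "a \<in> X" "b \<in> X" using that F by auto
    show ?thesis
      using two_point_approx[OF ab e' nonexpansive_mapsD(1)[OF f ab(1)] nonexpansive_mapsD(1)[OF f ab(2)]
          nonexpansive_mapsD(2)[OF f ab]] by blast
  qed
  then obtain K where K: "\<And>a b. a \<in> F \<Longrightarrow> b \<in> F \<Longrightarrow> K a b \<in> concepts n"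
    "\<And>a b. a \<in> F \<Longrightarrow> b \<in> F \<Longrightarrow> \<bar>interp I (K a b) a - f a\<bar> \<le> 3 * e'"
    "\<And>a b. a \<in> F \<Longrightarrow> b \<in> F \<Longrightarrow> \<bar>interp I (K a b) b - f b\<bar> \<le> 3 * e'"
    by metis
  have "\<exists>C. C \<in> concepts n \<and> (\<forall>x. interp I C x = (MIN b\<in>F. interp I (K a b) x))" if "a \<in> F" for a
    using finite_Min_concept[OF F(1) \<open>F \<noteq> {}\<close>, of "K a"] K(1)[OF that] by blast
  then obtain L where L: "\<And>a. a \<in> F \<Longrightarrow> L a \<in> concepts n"
    "\<And>a x. a \<in> F \<Longrightarrow> interp I (L a) x = (MIN b\<in>F. interp I (K a b) x)"
    by metis
  obtain C where C: "C \<in> concepts n" "\<And>x. interp I C x = (MAX a\<in>F. interp I (L a) x)"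
    using finite_Max_concept[OF F(1) \<open>F \<noteq> {}\<close>, of L] L(1) by blast
  have onF: "\<bar>interp I C z - f z\<bar> \<le> 3 * e'" if z: "z \<in> F" for z
  proof -
    have "interp I C z \<le> f z + 3 * e'"
    proof -
      have "interp I (L a) z \<le> f z + 3 * e'" if "a \<in> F" for a
      proof -
        have "interp I (L a) z \<le> interp I (K a z) z"
          unfolding L(2)[OF that] using F(1) z by (intro Min_le) auto
        then show ?thesis using K(3)[OF that z] by linarith
      qed
      then show ?thesis unfolding C(2) using F(1) \<open>F \<noteq> {}\<close> by (subst Max_le_iff) auto
    qed
    moreover have "f z - 3 * e' \<le> interp I C z"
    proof -
      have "f z - 3 * e' \<le> interp I (K z b) z" if "b \<in> F" for b
        using K(2)[OF z that] by linarith
      then have "f z - 3 * e' \<le> interp I (L z) z"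
        unfolding L(2)[OF z] using F(1) \<open>F \<noteq> {}\<close> by (subst Min_ge_iff) auto
      also have "\<dots> \<le> interp I C z"
        unfolding C(2) using F(1) z by (intro Max_ge) auto
      finally show ?thesis .
    qed
    ultimately show ?thesis by (simp add: abs_le_iff)
  qed
  have "\<bar>interp I C x - f x\<bar> \<le> e" if x: "x \<in> X" for x
  proof -
    have gx: "g x \<in> X" "g x \<in> F" using g(1)[OF x] F by auto
    have "\<bar>interp I C (g x) - interp I C x\<bar> \<le> dL NC I n (g x) x" by (rule dL_upper[OF C(1) gx(1) x])
    moreover have "\<bar>f (g x) - f x\<bar> \<le> dL NC I n (g x) x" by (rule nonexpansive_mapsD(2)[OF f gx(1) x])
    ultimately have "\<bar>interp I C x - f x\<bar> \<le> 5 * e'" using onF[OF gx(2)] g(2)[OF x] by linarith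
    then show ?thesis by (simp add: e'_def)
  qed
  then show ?thesis using C(1) by blast
qed

text \<open>States are classified by whether they block, by rounded atomic values, and by rounded
  expectations over a finite net of non-expansive maps, which control the Kantorovich supremum. The
  blocking flag separates states that the convention puts at distance 1.\<close>

lemma totally_bounded_Suc:
  assumes tb: "totally_bounded_pseudo X d" and d: "pseudometric_on X d"
  shows "totally_bounded_pseudo X (\<lambda>a b. max (atom_dist NC I a b) (kantorovich X d (role I a) (role I b)))"
proof (rule totally_bounded_pseudoI)
  fix e' :: real assume "0 < e'"
  \<comment> \<open>One part pays for rounding, and one for each of the two distributions when
    \<open>f\<close> is replaced by an element of the net.\<close>
  define e where "e = e' / 3"
  have e: "0 < e" "e \<le> e'" "3 * e = e'" using \<open>0 < e'\<close> by (auto simp: e_def)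
  obtain N where N: "finite N" "N \<subseteq> nonexpansive_maps X d"
    "\<And>f. f \<in> nonexpansive_maps X d \<Longrightarrow> \<exists>h\<in>N. \<forall>x\<in>X. \<bar>f x - h x\<bar> \<le> e"
    using nonexpansive_maps_finite_net[OF tb e(1)] by blast
  define \<Phi> where "\<Phi> a = (blocking I a, restrict (\<lambda>A. \<lfloor>conc I A a / e\<rfloor>) NC,
    restrict (\<lambda>h. \<lfloor>expect X (role I a) h / e\<rfloor>) N)" for a
  have "\<Phi> ` X \<subseteq> UNIV \<times> (NC \<rightarrow>\<^sub>E {0..\<lfloor>1 / e\<rfloor>}) \<times> (N \<rightarrow>\<^sub>E {0..\<lfloor>1 / e\<rfloor>})"
  proof (rule image_subsetI)
    fix a assume a: "a \<in> X"
    have "\<lfloor>conc I A a / e\<rfloor> \<in> {0..\<lfloor>1 / e\<rfloor>}" if "A \<in> NC" for A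
      by (rule floor_div_unit_interval[OF e(1) conc_unit_interval[OF that a]])
    moreover have "\<lfloor>expect X (role I a) h / e\<rfloor> \<in> {0..\<lfloor>1 / e\<rfloor>}" if "h \<in> N" for h
      by (intro floor_div_unit_interval[OF e(1)] expect_role_unit_interval[OF a]
          nonexpansive_mapsD(1)[OF subsetD[OF N(2) that]])
    ultimately show "\<Phi> a \<in> UNIV \<times> (NC \<rightarrow>\<^sub>E {0..\<lfloor>1 / e\<rfloor>}) \<times> (N \<rightarrow>\<^sub>E {0..\<lfloor>1 / e\<rfloor>})"
      unfolding \<Phi>_def by (simp add: restrict_PiE_iff)
  qed
  moreover have "finite (UNIV \<times> (NC \<rightarrow>\<^sub>E {0..\<lfloor>1 / e\<rfloor>}) \<times> (N \<rightarrow>\<^sub>E {0..\<lfloor>1 / e\<rfloor>}) ::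
      (bool \<times> ('c \<Rightarrow> int) \<times> (('s \<Rightarrow> real) \<Rightarrow> int)) set)"
    using finite_NC N(1) by (intro finite_cartesian_product finite_PiE) auto
  ultimately have "finite (\<Phi> ` X)" by (rule finite_subset)
  moreover have "max (atom_dist NC I a b) (kantorovich X d (role I a) (role I b)) \<le> e'"
    if ab: "a \<in> X" "b \<in> X" and eq: "\<Phi> a = \<Phi> b" for a b
  proof -
    have blk: "blocking I a \<longleftrightarrow> blocking I b" using eq by (simp add: \<Phi>_def)
    have "\<bar>conc I A a - conc I A b\<bar> \<le> e" if "A \<in> NC" for A
    proof (rule floor_div_eq_close[OF e(1)])
      have "restrict (\<lambda>A. \<lfloor>conc I A a / e\<rfloor>) NC = restrict (\<lambda>A. \<lfloor>conc I A b / e\<rfloor>) NC"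
        using eq by (simp add: \<Phi>_def)
      from fun_cong[OF this, of A] show "\<lfloor>conc I A a / e\<rfloor> = \<lfloor>conc I A b / e\<rfloor>" using that by simp
    qed
    then have "atom_dist NC I a b \<le> e'"
      using e by (fastforce simp: atom_dist_le_iff)
    moreover have "kantorovich X d (role I a) (role I b) \<le> e'"
    proof (cases "blocking I a")
      case True
      then show ?thesis using blk kantorovich_blocking[OF ab] \<open>0 < e'\<close> by simp
    next
      case False
      have dd: "discrete_dist X (role I a)" "discrete_dist X (role I b)"
        using nonblocking_discrete_dist ab False blk by auto
      have exp_h: "\<bar>expect X (role I a) h - expect X (role I b) h\<bar> \<le> e" if "h \<in> N" for h
      proof (rule floor_div_eq_close[OF e(1)])
        have "restrict (\<lambda>h. \<lfloor>expect X (role I a) h / e\<rfloor>) N = restrict (\<lambda>h. \<lfloor>expect X (role I b) h / e\<rfloor>) N"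
          using eq by (simp add: \<Phi>_def)
        from fun_cong[OF this, of h] show "\<lfloor>expect X (role I a) h / e\<rfloor> = \<lfloor>expect X (role I b) h / e\<rfloor>"
          using that by simp
      qed
      show ?thesis
      proof (rule kantorovich_least[OF dd])
        show "0 \<le> d x y" if "x \<in> X" "y \<in> X" for x y
          using d that by (auto simp: pseudometric_on_def)
        fix f assume f: "f \<in> nonexpansive_maps X d"
        then obtain h where h: "h \<in> N" "\<And>x. x \<in> X \<Longrightarrow> \<bar>f x - h x\<bar> \<le> e" using N(3) by blast
        have near: "\<bar>expect X \<pi> f - expect X \<pi> h\<bar> \<le> e" if "discrete_dist X \<pi>" for \<pi>
          using nonexpansive_mapsD(3)[OF f] nonexpansive_mapsD(3)[OF subsetD[OF N(2) h(1)]] h(2)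
          by (rule expect_diff_le[OF that])
        show "\<bar>expect X (role I a) f - expect X (role I b) f\<bar> \<le> e'"
          using near[OF dd(1)] near[OF dd(2)] exp_h[OF h(1)] e(3) by linarith
      qed
    qed
    ultimately show ?thesis by simp
  qed
  ultimately show "\<exists>\<Phi> :: 's \<Rightarrow> bool \<times> ('c \<Rightarrow> int) \<times> (('s \<Rightarrow> real) \<Rightarrow> int). finite (\<Phi> ` X) \<and>
      (\<forall>a\<in>X. \<forall>b\<in>X. \<Phi> a = \<Phi> b \<longrightarrow> max (atom_dist NC I a b) (kantorovich X d (role I a) (role I b)) \<le> e')"
    by blast
qed

lemma restrict_interp_nonexpansive:
  assumes "C \<in> concepts n"
  shows "restrict (interp I C) X \<in> nonexpansive_maps X (dL NC I n)"
  using dL_upper[OF assms] interp_unit_interval[OF conceptsD[OF assms]]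
  by (auto simp: nonexpansive_maps_def simp del: atLeastAtMost_iff)

text \<open>The propositional connectives do not increase differences, so the bound passes through
  them. At \<open>Diamond\<close> the argument has rank at most \<open>n\<close> and is itself a
  competitor in the Kantorovich supremum.\<close>

lemma interp_Suc_nonexpansive:
  assumes "C \<in> concepts (Suc n)" and ab: "a \<in> X" "b \<in> X"
  shows "\<bar>interp I C a - interp I C b\<bar>
    \<le> max (atom_dist NC I a b) (kantorovich X (dL NC I n) (role I a) (role I b))" (is "_ \<le> ?M")
  using assms(1)
proof (induction C)
  case (Rational q)
  then show ?case using atom_dist_nonneg[of a b] by (simp add: le_max_iff_disj)
next
  case (Atom A)
  then show ?case using atom_dist_upper[of A a b] by (simp add: le_max_iff_disj)
next
  case (Minus C q)
  then have "\<bar>interp I C a - interp I C b\<bar> \<le> ?M" by simp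
  then show ?case unfolding interp.simps by linarith
next
  case (Neg C)
  then have "\<bar>interp I C a - interp I C b\<bar> \<le> ?M" by simp
  then show ?case unfolding interp.simps by linarith
next
  case (Conj C D)
  then have "\<bar>interp I C a - interp I C b\<bar> \<le> ?M" "\<bar>interp I D a - interp I D b\<bar> \<le> ?M" by simp_all
  then show ?case unfolding interp.simps by linarith
next
  case (Diamond C)
  then have C: "C \<in> concepts n" by simp
  have "\<bar>interp I (Diamond C) a - interp I (Diamond C) b\<bar> \<le> kantorovich X (dL NC I n) (role I a) (role I b)"
  proof (cases "blocking I a \<or> blocking I b")
    case True
    have "\<bar>interp I (Diamond C) a - interp I (Diamond C) b\<bar> \<le> 1"
      by (rule interp_diff_le_1[OF Diamond.prems ab])
    then show ?thesis
      using True kantorovich_blocking[OF ab True] expect_blocking ab by auto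
  next
    case False
    then have dd: "discrete_dist X (role I a)" "discrete_dist X (role I b)"
      using nonblocking_discrete_dist ab by auto
    have "expect X \<pi> (restrict (interp I C) X) = expect X \<pi> (interp I C)" for \<pi>
      by (rule expect_cong) simp
    then show ?thesis
      using kantorovich_upper[OF dd restrict_interp_nonexpansive[OF C]] by simp
  qed
  then show ?case by (simp add: le_max_iff_disj)
qed

text \<open>Each competitor in the supremum is uniformly close to some concept \<open>C\<close> of
  rank at most \<open>n\<close>, and \<open>Diamond C\<close> turns the difference of expectations
  into a difference of concept values one rank higher.\<close>

lemma kantorovich_le_dL_Suc:
  assumes tb: "totally_bounded_pseudo X (dL NC I n)" and ab: "a \<in> X" "b \<in> X"
  shows "kantorovich X (dL NC I n) (role I a) (role I b) \<le> dL NC I (Suc n) a b"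
proof (cases "blocking I a \<or> blocking I b")
  case True
  show ?thesis
  proof (cases "blocking I a = blocking I b")
    case True
    then show ?thesis
      using kantorovich_blocking[OF ab] \<open>blocking I a \<or> blocking I b\<close> dL_nonneg[OF ab] by simp
  next
    case False
    \<comment> \<open>\<open>Diamond (Rational 1)\<close> is 0 at blocking states and 1 at all
      others, so it attains the distance 1 that the convention prescribes.\<close>
    have "expect X (role I c) (\<lambda>x. 1) = of_bool (\<not> blocking I c)" if "c \<in> X" for c
      using that expect_blocking expect_const[OF nonblocking_discrete_dist[OF that]] by auto
    then have "\<bar>interp I (Diamond (Rational 1)) a - interp I (Diamond (Rational 1)) b\<bar> = 1"
      using False ab by auto
    then show ?thesis
      using dL_upper[of "Diamond (Rational 1)" "Suc n" a b] ab kantorovich_blocking[OF ab True] by simp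
  qed
next
  case False
  then have dd: "discrete_dist X (role I a)" "discrete_dist X (role I b)"
    using nonblocking_discrete_dist ab by auto
  show ?thesis
  proof (rule kantorovich_least[OF dd dL_nonneg])
    fix f assume f: "f \<in> nonexpansive_maps X (dL NC I n)"
    show "\<bar>expect X (role I a) f - expect X (role I b) f\<bar> \<le> dL NC I (Suc n) a b"
    proof (rule field_le_epsilon)
      fix e :: real assume "0 < e"
      then have "0 < e / 2" by simp
      from concepts_dense[OF tb f this] obtain C
        where C: "C \<in> concepts n" "\<And>x. x \<in> X \<Longrightarrow> \<bar>interp I C x - f x\<bar> \<le> e / 2" by blast
      have "\<bar>interp I C x\<bar> \<le> 1" if "x \<in> X" for x
        using interp_unit_interval[OF conceptsD[OF C(1)] that] by simp
      then have near: "\<bar>expect X \<pi> (interp I C) - expect X \<pi> f\<bar> \<le> e / 2" if "discrete_dist X \<pi>" for \<pi>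
        using nonexpansive_mapsD(3)[OF f] C(2) by (rule expect_diff_le[OF that])
      have "\<bar>interp I (Diamond C) a - interp I (Diamond C) b\<bar> \<le> dL NC I (Suc n) a b"
        using C(1) ab by (intro dL_upper) simp_all
      then show "\<bar>expect X (role I a) f - expect X (role I b) f\<bar> \<le> dL NC I (Suc n) a b + e"
        using near[OF dd(1)] near[OF dd(2)] unfolding interp.simps by linarith
    qed
  qed
qed

lemma dL_Suc:
  assumes "totally_bounded_pseudo X (dL NC I n)" "a \<in> X" "b \<in> X"
  shows "dL NC I (Suc n) a b = max (atom_dist NC I a b) (kantorovich X (dL NC I n) (role I a) (role I b))"
proof (rule antisym)
  show "dL NC I (Suc n) a b \<le> max (atom_dist NC I a b) (kantorovich X (dL NC I n) (role I a) (role I b))"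
    using assms by (intro dL_least interp_Suc_nonexpansive)
  have "atom_dist NC I a b \<le> dL NC I (Suc n) a b"
    unfolding atom_dist_le_iff
  proof (intro conjI ballI dL_nonneg assms)
    fix A assume "A \<in> NC"
    then show "\<bar>conc I A a - conc I A b\<bar> \<le> dL NC I (Suc n) a b"
      using dL_upper[of "Atom A" "Suc n" a b] assms by simp
  qed
  then show "max (atom_dist NC I a b) (kantorovich X (dL NC I n) (role I a) (role I b)) \<le> dL NC I (Suc n) a b"
    using kantorovich_le_dL_Suc[OF assms] by simp
qed

lemma dL_0: "a \<in> X \<Longrightarrow> b \<in> X \<Longrightarrow> dL NC I 0 a b = 0"
proof (rule antisym)
  show "dL NC I 0 a b \<le> 0"
  proof (rule dL_least)
    \<comment> \<open>Rank 0 excludes \<open>Atom\<close> and \<open>Diamond\<close>, so such a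
      concept is constant.\<close>
    fix C assume "C \<in> concepts 0"
    then show "\<bar>interp I C a - interp I C b\<bar> \<le> 0"
      by (induction C) (auto simp: concepts_def)
  qed
qed (rule dL_nonneg)

section \<open>Total boundedness at every level, and agreement with the lifted distances\<close>

lemma dL_totally_bounded: "totally_bounded_pseudo X (dL NC I n)"
proof (induction n)
  case 0
  show ?case
    by (rule totally_bounded_pseudoI[where ?'b = unit]) (auto simp: dL_0 finite_subset[OF subset_UNIV])
next
  case (Suc n)
  from totally_bounded_Suc[OF this dL_pseudometric] show ?case
    using totally_bounded_pseudo_cong[of X "dL NC I (Suc n)"
        "\<lambda>a b. max (atom_dist NC I a b) (kantorovich X (dL NC I n) (role I a) (role I b))"] dL_Suc[OF Suc]
    by simp
qed

lemma dK_eq_dL: "a \<in> X \<Longrightarrow> b \<in> X \<Longrightarrow> dK NC I n a b = dL NC I n a b"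
proof (induction n arbitrary: a b)
  case (Suc n)
  have "kantorovich X (dK NC I n) (role I a) (role I b) = kantorovich X (dL NC I n) (role I a) (role I b)"
    by (rule kantorovich_cong) (rule Suc.IH)
  then show ?case
    using dL_Suc[OF dL_totally_bounded Suc.prems] by simp
qed (simp add: dL_0)

lemma dW_eq_dL: "a \<in> X \<Longrightarrow> b \<in> X \<Longrightarrow> dW NC I n a b = dL NC I n a b"
proof (induction n arbitrary: a b)
  case (Suc n)
  have "wasserstein X (dW NC I n) (role I a) (role I b) = wasserstein X (dL NC I n) (role I a) (role I b)"
    by (rule wasserstein_cong) (rule Suc.IH)
  \<comment> \<open>Duality is applied to \<open>dL\<close>, for which total boundedness is already
    established.\<close>
  also have "\<dots> = kantorovich X (dL NC I n) (role I a) (role I b)"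
    using zero_on_or_discrete_dist Suc.prems dL_pseudometric dL_totally_bounded dL_le_1
    by (intro kantorovich_wasserstein_duality) auto
  finally show ?case
    using dL_Suc[OF dL_totally_bounded Suc.prems] by simp
qed (simp add: dL_0)

end

section \<open>Density in the space of non-expansive maps\<close>

lemma mspace_nonexpansive_space: "mspace (nonexpansive_space X d) = nonexpansive_maps X d"
proof -
  have "bounded (f ` X)" if "f \<in> nonexpansive_maps X d" for f
    using nonexpansive_mapsD(1)[OF that] by (intro bounded_subset[OF bounded_closed_interval[of 0 1]]) blast
  then show ?thesis
    by (auto simp: nonexpansive_space_def Met_TC.fspace_def nonexpansive_maps_def PiE_def)
qed

text \<open>For empty \<open>X\<close> the pointwise bound says nothing about the sign of
  \<open>e\<close>, so nonnegativity is assumed separately.\<close>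

lemma mdist_nonexpansive_space_le:
  assumes "f \<in> nonexpansive_maps X d" "h \<in> nonexpansive_maps X d" "0 \<le> e"
    and "\<And>x. x \<in> X \<Longrightarrow> \<bar>f x - h x\<bar> \<le> e"
  shows "mdist (nonexpansive_space X d) f h \<le> e"
  using assms(3,4) by (auto simp: nonexpansive_space_def Met_TC.fdist_def dist_real_def intro!: cSUP_least)

text \<open>The approximations allow equality with \<open>e\<close>, which fits the description of
  the closure by closed balls.\<close>

lemma dense_subset_nonexpansive_spaceI:
  assumes S: "S \<subseteq> nonexpansive_maps X d"
    and approx: "\<And>f e. f \<in> nonexpansive_maps X d \<Longrightarrow> 0 < e \<Longrightarrow> \<exists>h\<in>S. \<forall>x\<in>X. \<bar>h x - f x\<bar> \<le> e"
  shows "dense_subset (nonexpansive_space X d) S"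
proof -
  let ?m = "nonexpansive_space X d"
  have "\<exists>h\<in>S. h \<in> mcball_of ?m f e" if f: "f \<in> nonexpansive_maps X d" and e: "0 < e" for f e
  proof -
    obtain h where h: "h \<in> S" "\<And>x. x \<in> X \<Longrightarrow> \<bar>h x - f x\<bar> \<le> e" using approx[OF f e] by blast
    have "h \<in> nonexpansive_maps X d" using S h(1) by blast
    moreover from this have "mdist ?m f h \<le> e"
      using f e h(2) by (intro mdist_nonexpansive_space_le) (auto simp: abs_minus_commute)
    ultimately show ?thesis
      using f h(1) by (intro bexI[of _ h]) (simp_all add: mspace_nonexpansive_space)
  qed
  then have "mtopology_of ?m closure_of S = mspace ?m"
    unfolding mtopology_of_def Metric_space.metric_closure_of_alt[OF Metric_space_mspace_mdist]
    by (auto simp: mcball_of_def mspace_nonexpansive_space)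
  then show ?thesis using S by (simp add: dense_subset_def mspace_nonexpansive_space)
qed

section \<open>The bisimulation game\<close>

context finite_alc_model
begin

lemma spoiler_wins_now_antimono:
  "spoiler_wins_now NC I a b e' \<Longrightarrow> e \<le> e' \<Longrightarrow> spoiler_wins_now NC I a b e"
  by (fastforce simp: spoiler_wins_now_def)

text \<open>A larger budget admits the same move. The bound \<open>e' \<le> 1\<close> protects
  Duplicator's immediate win at budget 1.\<close>

lemma duplicator_wins_mono:
  assumes "duplicator_wins NC I n a b e" "e \<le> e'" "e' \<le> 1"
  shows "duplicator_wins NC I n a b e'"
proof (cases n)
  case (Suc m)
  have "\<not> spoiler_wins_now NC I a b e'"
    using assms spoiler_wins_now_antimono Suc by auto
  moreover have "duplicator_wins_now I a b e \<Longrightarrow> duplicator_wins_now I a b e'"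
    using assms by (auto simp: duplicator_wins_now_def)
  ultimately show ?thesis
    using assms(1) order_trans[OF _ assms(2)] unfolding Suc duplicator_wins.simps by blast
qed simp

text \<open>Makes the infimum in \<open>dG\<close> range over a nonempty set and supplies a budget
  that always wins.\<close>

lemma duplicator_wins_1:
  assumes "a \<in> X" "b \<in> X"
  shows "duplicator_wins NC I n a b 1"
proof (cases n)
  case (Suc m)
  have "\<bar>conc I A a - conc I A b\<bar> \<le> 1" if "A \<in> NC" for A
    using conc_unit_interval[OF that assms(1)] conc_unit_interval[OF that assms(2)] by auto
  then show ?thesis
    using Suc by (force simp: spoiler_wins_now_def duplicator_wins_now_def)
qed simp

lemma dG_lower:
  assumes "duplicator_wins NC I n a b e" "0 \<le> e" "e \<le> 1"
  shows "dG NC I n a b \<le> e"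
  unfolding dG_def using assms by (intro cInf_lower bdd_belowI[of _ 0]) auto

lemma dG_greatest:
  assumes "a \<in> X" "b \<in> X"
    and "\<And>e. duplicator_wins NC I n a b e \<Longrightarrow> 0 \<le> e \<Longrightarrow> e \<le> 1 \<Longrightarrow> K \<le> e"
  shows "K \<le> dG NC I n a b"
  unfolding dG_def using assms duplicator_wins_1[OF assms(1,2), of n] by (intro cInf_greatest) auto

text \<open>Attainment of the infimum is not claimed, hence the strict inequality; monotonicity
  covers every budget above it.\<close>

lemma duplicator_wins_above_dG:
  assumes "a \<in> X" "b \<in> X" "dG NC I n a b < e" "e \<le> 1"
  shows "duplicator_wins NC I n a b e"
proof -
  have "{\<epsilon> \<in> {0..1}. duplicator_wins NC I n a b \<epsilon>} \<noteq> {}"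
    using duplicator_wins_1[OF assms(1,2), of n] by force
  from cInf_lessD[OF this] assms(3) obtain e0 where "duplicator_wins NC I n a b e0" "e0 < e"
    unfolding dG_def by blast
  then show ?thesis using duplicator_wins_mono assms(4) by (meson less_imp_le)
qed

lemma dL_Suc_wasserstein:
  assumes "a \<in> X" "b \<in> X"
  shows "dL NC I (Suc n) a b = max (atom_dist NC I a b) (wasserstein X (dL NC I n) (role I a) (role I b))"
  using dW_eq_dL[OF assms, of "Suc n"] wasserstein_cong[of X "dW NC I n" "dL NC I n"] dW_eq_dL[of _ _ n]
  by simp

lemma expect_dL_coupling_bounded:
  "x \<in> X \<times> X \<Longrightarrow> \<bar>case x of (x, y) \<Rightarrow> dL NC I n x y\<bar> \<le> 1"
  using dL_nonneg dL_le_1 by (auto simp: abs_le_iff intro: order_trans[of _ 0])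

text \<open>Duplicator plays a coupling with expected distance below \<open>e\<close> and adds the
  surplus to the budget of every successor pair. Below the cap at 1, this puts the budget strictly
  above the game distance of the pair, where Duplicator wins.\<close>

lemma duplicator_wins_above_dL_Suc:
  assumes IH: "\<And>x y. x \<in> X \<Longrightarrow> y \<in> X \<Longrightarrow> dG NC I n x y = dL NC I n x y"
    and ab: "a \<in> X" "b \<in> X" and e: "dL NC I (Suc n) a b < e" "e \<le> 1"
  shows "duplicator_wins NC I (Suc n) a b e"
proof -
  let ?W = "wasserstein X (dL NC I n) (role I a) (role I b)"
  have less: "atom_dist NC I a b < e" "?W < e"
    using e(1) unfolding dL_Suc_wasserstein[OF ab] by auto
  have blk: "blocking I a \<longleftrightarrow> blocking I b"
  proof (rule ccontr)
    assume "\<not> ?thesis"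
    moreover from this have "?W = 1" using wasserstein_blocking[OF ab] by auto
    ultimately show False using less(2) e(2) by simp
  qed
  have "\<bar>conc I A a - conc I A b\<bar> \<le> e" if "A \<in> NC" for A
    using atom_dist_upper[OF that, of a b] less(1) by linarith
  then have spoiler: "\<not> spoiler_wins_now NC I a b e"
    using blk by (force simp: spoiler_wins_now_def)
  show ?thesis
  proof (cases "blocking I a")
    case True
    then show ?thesis using blk spoiler by (simp add: duplicator_wins_now_def)
  next
    case False
    then have dd: "discrete_dist X (role I a)" "discrete_dist X (role I b)"
      using nonblocking_discrete_dist ab blk by auto
    have "\<exists>\<mu>\<in>couplings X (role I a) (role I b). expect (X \<times> X) \<mu> (\<lambda>(x, y). dL NC I n x y) < e"
    proof (rule ccontr)
      assume "\<not> ?thesis"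
      then have "e \<le> ?W" by (intro wasserstein_greatest[OF dd]) (force simp: not_less)
      then show False using less(2) by simp
    qed
    then obtain \<mu> where \<mu>: "\<mu> \<in> couplings X (role I a) (role I b)"
      and less_e: "expect (X \<times> X) \<mu> (\<lambda>(x, y). dL NC I n x y) < e" by blast
    \<comment> \<open>Adding the constant surplus raises the expectation exactly to
      \<open>e\<close>; the cap at 1 in \<open>\<epsilon>\<close> keeps the budgets admissible and
      can only lower the expectation.\<close>
    define \<delta> where "\<delta> = e - expect (X \<times> X) \<mu> (\<lambda>(x, y). dL NC I n x y)"
    define \<epsilon> where "\<epsilon> = (\<lambda>(x, y). min 1 (dL NC I n x y + \<delta>))"
    have "0 < \<delta>" using less_e by (simp add: \<delta>_def)
    have dm: "discrete_dist (X \<times> X) \<mu>" using \<mu> by (simp add: couplings_def)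
    have \<epsilon>: "\<epsilon> \<in> X \<times> X \<rightarrow> {0..1}"
      using dL_nonneg \<open>0 < \<delta>\<close> by (auto simp: \<epsilon>_def intro!: add_nonneg_nonneg)
    have "expect (X \<times> X) \<mu> \<epsilon> \<le> expect (X \<times> X) \<mu> (\<lambda>z. (\<lambda>(x, y). dL NC I n x y) z + \<delta>)"
    proof (rule expect_mono[OF dm, where B = 1 and C = "1 + \<delta>"])
      fix z assume z: "z \<in> X \<times> X"
      show "\<bar>\<epsilon> z\<bar> \<le> 1" using funcset_mem[OF \<epsilon> z] by simp
      show "\<bar>(case z of (x, y) \<Rightarrow> dL NC I n x y) + \<delta>\<bar> \<le> 1 + \<delta>"
        using expect_dL_coupling_bounded[OF z, of n] \<open>0 < \<delta>\<close> by linarith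
      show "\<epsilon> z \<le> (case z of (x, y) \<Rightarrow> dL NC I n x y) + \<delta>"
        by (simp add: \<epsilon>_def case_prod_unfold)
    qed
    also have "\<dots> = expect (X \<times> X) \<mu> (\<lambda>(x, y). dL NC I n x y) + expect (X \<times> X) \<mu> (\<lambda>z. \<delta>)"
      using expect_dL_coupling_bounded by (intro expect_add[OF dm, where B = 1 and C = "\<bar>\<delta>\<bar>"]) auto
    also have "\<dots> = e" by (simp add: expect_const[OF dm] \<delta>_def)
    finally have "expect (X \<times> X) \<mu> \<epsilon> \<le> e" .
    moreover have "duplicator_wins NC I n x y (\<epsilon> (x, y))" if xy: "x \<in> X" "y \<in> X" for x y
    \<comment> \<open>At the cap the budget may fail to exceed the distance strictly, but budget 1
      always wins.\<close>
    proof (cases "\<epsilon> (x, y) = 1")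
      case True
      then show ?thesis using duplicator_wins_1[OF xy] by simp
    next
      case False
      then have "dG NC I n x y < \<epsilon> (x, y)" "\<epsilon> (x, y) \<le> 1"
        using IH[OF xy] \<open>0 < \<delta>\<close> by (auto simp: \<epsilon>_def min_def split: if_splits)
      then show ?thesis by (rule duplicator_wins_above_dG[OF xy])
    qed
    ultimately show ?thesis
      using \<mu> \<epsilon> spoiler unfolding duplicator_wins.simps by blast
  qed
qed

text \<open>Duplicator's coupling is a competitor in the Wasserstein infimum. At pairs of positive
  mass the successor budget wins and so dominates \<open>dL\<close>, hence the expected distance is
  at most the expected budget.\<close>

lemma dL_Suc_le_if_duplicator_wins:
  assumes IH: "\<And>x y. x \<in> X \<Longrightarrow> y \<in> X \<Longrightarrow> dG NC I n x y = dL NC I n x y"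
    and ab: "a \<in> X" "b \<in> X" and e: "duplicator_wins NC I (Suc n) a b e" "0 \<le> e" "e \<le> 1"
  shows "dL NC I (Suc n) a b \<le> e"
proof -
  have spoiler: "\<not> spoiler_wins_now NC I a b e" using e(1) by simp
  then have "atom_dist NC I a b \<le> e"
    using e(2) by (force simp: atom_dist_le_iff spoiler_wins_now_def)
  moreover have "wasserstein X (dL NC I n) (role I a) (role I b) \<le> e"
  proof (cases "blocking I a \<or> blocking I b")
    case True
    then show ?thesis
      using spoiler e wasserstein_blocking[OF ab True] by (auto simp: spoiler_wins_now_def)
  next
    case False
    then have dd: "discrete_dist X (role I a)" "discrete_dist X (role I b)"
      using nonblocking_discrete_dist ab by auto
    obtain \<mu> where \<mu>: "\<mu> \<in> couplings X (role I a) (role I b)"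
      and exp: "expect (X \<times> X) \<mu> (\<lambda>(x, y). dL NC I n x y) \<le> e"
    \<comment> \<open>At \<open>e = 1\<close> Duplicator may win without moving, so there need be no
      move to extract a coupling from; any coupling will do, since \<open>dL\<close> is bounded by
      1.\<close>
    proof (cases "e = 1")
      case True
      obtain \<mu> where \<mu>: "\<mu> \<in> couplings X (role I a) (role I b)"
        using couplings_nonempty[OF dd] by blast
      have "expect (X \<times> X) \<mu> (\<lambda>(x, y). dL NC I n x y) \<in> {0..1}"
        using \<mu> dL_nonneg dL_le_1 by (intro expect_in_unit_interval) (auto simp: couplings_def)
      then show thesis using that[OF \<mu>] True by simp
    next
      case ne: False
      then obtain \<mu> \<epsilon> where \<mu>: "\<mu> \<in> couplings X (role I a) (role I b)"
        and \<epsilon>: "\<epsilon> \<in> X \<times> X \<rightarrow> {0..1}" "expect (X \<times> X) \<mu> \<epsilon> \<le> e"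
        and win: "\<And>x y. x \<in> X \<Longrightarrow> y \<in> X \<Longrightarrow> 0 < \<mu> (x, y) \<Longrightarrow> duplicator_wins NC I n x y (\<epsilon> (x, y))"
        using e(1) False unfolding duplicator_wins.simps duplicator_wins_now_def by blast
      have dm: "discrete_dist (X \<times> X) \<mu>" using \<mu> by (simp add: couplings_def)
      have "expect (X \<times> X) \<mu> (\<lambda>(x, y). dL NC I n x y) \<le> expect (X \<times> X) \<mu> \<epsilon>"
      proof (rule expect_mono[OF dm expect_dL_coupling_bounded, where C = 1])
        fix z assume z: "z \<in> X \<times> X"
        have u: "\<epsilon> z \<in> {0..1}" by (rule funcset_mem[OF \<epsilon>(1) z])
        then show "\<bar>\<epsilon> z\<bar> \<le> 1" by simp
        assume pos: "0 < \<mu> z"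
        obtain x y where xy: "z = (x, y)" "x \<in> X" "y \<in> X" using z by auto
        have "dG NC I n x y \<le> \<epsilon> z"
          using win[OF xy(2,3)] pos u xy(1) by (intro dG_lower) auto
        then show "(case z of (x, y) \<Rightarrow> dL NC I n x y) \<le> \<epsilon> z"
          using IH[OF xy(2,3)] xy(1) by simp
      qed
      then show thesis using that[OF \<mu>] \<epsilon>(2) by linarith
    qed
    have "wasserstein X (dL NC I n) (role I a) (role I b) \<le> expect (X \<times> X) \<mu> (\<lambda>(x, y). dL NC I n x y)"
      using dL_nonneg by (intro wasserstein_lower[OF dd _ \<mu>])
    then show ?thesis using exp by linarith
  qed
  ultimately show ?thesis by (simp add: dL_Suc_wasserstein[OF ab])
qed

lemma dG_eq_dL: "a \<in> X \<Longrightarrow> b \<in> X \<Longrightarrow> dG NC I n a b = dL NC I n a b"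
proof (induction n arbitrary: a b)
  case 0
  have "dG NC I 0 a b = 0"
    by (intro antisym dG_lower dG_greatest 0) auto
  then show ?case using dL_0 0 by simp
next
  case (Suc n)
  show ?case
  proof (rule antisym)
    show "dL NC I (Suc n) a b \<le> dG NC I (Suc n) a b"
      by (rule dG_greatest[OF Suc.prems]) (rule dL_Suc_le_if_duplicator_wins[OF Suc.IH Suc.prems])
    show "dG NC I (Suc n) a b \<le> dL NC I (Suc n) a b"
    proof (rule ccontr)
      assume "\<not> ?thesis"
      \<comment> \<open>A budget strictly between the two distances would win although it lies below
        the infimum of winning budgets.\<close>
      then obtain e where e: "dL NC I (Suc n) a b < e" "e < dG NC I (Suc n) a b"
        using dense[of "dL NC I (Suc n) a b" "dG NC I (Suc n) a b"] by (auto simp: not_le)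
      have "dG NC I (Suc n) a b \<le> 1"
        by (rule dG_lower[OF duplicator_wins_1[OF Suc.prems]]) simp_all
      with e have "e \<le> 1" by simp
      have "0 \<le> e" using dL_nonneg[OF Suc.prems, of "Suc n"] e(1) by simp
      have "dG NC I (Suc n) a b \<le> e"
        using duplicator_wins_above_dL_Suc[OF Suc.IH Suc.prems e(1) \<open>e \<le> 1\<close>] \<open>0 \<le> e\<close> \<open>e \<le> 1\<close>
        by (rule dG_lower)
      with e(2) show False by simp
    qed
  qed
qed

end

theorem theorem15:
  fixes NC :: "'c set" and I :: "('s, 'c) model" and n :: nat
  assumes "finite NC" and "is_model NC I"
  shows "(\<forall>a\<in>states I. \<forall>b\<in>states I.
            dG NC I n a b = dW NC I n a b \<and>
            dW NC I n a b = dK NC I n a b \<and>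
            dK NC I n a b = dL NC I n a b) \<and>
         pseudometric_on (states I) (dG NC I n) \<and>
         totally_bounded_pseudo (states I) (dG NC I n) \<and>
         dense_subset (nonexpansive_space (states I) (dG NC I n))
           {restrict (interp I C) (states I) | C. concept_over NC C \<and> rk C \<le> n}"
proof -
  interpret finite_alc_model NC I by unfold_locales fact+
  \<comment> \<open>Density is known for the logical distance; equality on the states makes the two
    sets of non-expansive maps coincide.\<close>
  have maps: "nonexpansive_maps X (dG NC I n) = nonexpansive_maps X (dL NC I n)"
    by (rule nonexpansive_maps_cong) (rule dG_eq_dL)
  have "dense_subset (nonexpansive_space X (dG NC I n)) {restrict (interp I C) X | C. C \<in> concepts n}"
  proof (rule dense_subset_nonexpansive_spaceI)
    show "{restrict (interp I C) X | C. C \<in> concepts n} \<subseteq> nonexpansive_maps X (dG NC I n)"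
      unfolding maps using restrict_interp_nonexpansive by blast
    fix f and e :: real assume "f \<in> nonexpansive_maps X (dG NC I n)" "0 < e"
    then obtain C where "C \<in> concepts n" "\<And>x. x \<in> X \<Longrightarrow> \<bar>interp I C x - f x\<bar> \<le> e"
      unfolding maps using concepts_dense[OF dL_totally_bounded] by blast
    then show "\<exists>h\<in>{restrict (interp I C) X | C. C \<in> concepts n}. \<forall>x\<in>X. \<bar>h x - f x\<bar> \<le> e"
      by (intro bexI[of _ "restrict (interp I C) X"]) auto
  qed
  moreover have "pseudometric_on X (dG NC I n)"
    using dL_pseudometric[of n] by (simp add: pseudometric_on_def dG_eq_dL)
  moreover have "totally_bounded_pseudo X (dG NC I n)"
    using dL_totally_bounded totally_bounded_pseudo_cong[of X "dG NC I n" "dL NC I n"] dG_eq_dL by simp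
  ultimately show ?thesis
    by (simp add: dG_eq_dL dW_eq_dL dK_eq_dL concepts_def)
qed

end
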